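(* Let $T$ be a (finite) tree with at least $2$ vertices and let $\beta=\beta(T)$. (i) If $\beta$ is not of the form $2^k-1$ for any integer $k\ge 1$, then $SIG_\infty(T)=\lceil \log_2(\beta+2)\rceil$. (ii) If $\beta=2^k-1$ for some integer $k\ge 1$, then $SIG_\infty(T)\in\{k,k+1\}$. Moreover, both values in (ii) can be achieved: for every integer $k\ge 1$ there exist a tree $T_1$ with $\beta(T_1)=2^k-1$ and $SIG_\infty(T_1)=k$, and a tree $T_2$ with $\beta(T_2)=2^k-1$ and $SIG_\infty(T_2)=k+1$.
   Context: Leaf-degrees. Let $T=(V,E)$ be an unrooted finite tree with $|V|\ge 2$. A leaf is a vertex of degree $1$. For $x\in V$ let $P(x)$ be the set of neighbors of $x$ that are leaves, and let $\alpha(T)=\max_{x\in V}|P(x)|$. Let $S=\{v\in V : |P(v)|=\alpha(T)\}$. Define $\beta(T)=\alpha(T)$ if $|S|\ge 2$, and $\beta(T)=\alpha(T)-1$ if $|S|=1$. Sphere-of-influence graphs. For $x,y\in\mathbb{R}^d$ let $\rho(x,y)=\max_{1\le i\le d}|x[i]-y[i]|$ (the $L_\infty$ metric), where $x[i]$ is the $i$-th coordinate of $x$, and let $B(p,r)=\{x\in\mathbb{R}^d : \rho(x,p)<r\}$ be the open ball. For a finite set $\mathcal{P}\subset\mathbb{R}^d$ of (distinct) points with $|\mathcal{P}|\ge 2$ and $p\in\mathcal{P}$, let $r_p=\min\{\rho(p,q) : q\in\mathcal{P}, q\ne p\}$. The sphere-of-influence graph (SIG) of $\mathcal{P}$ is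 the intersection graph of the family $\{B(p,r_p) : p\in\mathcal{P}\}$: it has one vertex for each $p\in\mathcal{P}$, and two distinct vertices $p,q$ are adjacent if and only if $B(p,r_p)\cap B(q,r_q)\neq\emptyset$. A $d$-dimensional SIG representation of a graph $G$ (under $L_\infty$) is a set $\mathcal{P}_G\subset\mathbb{R}^d$ whose SIG is (isomorphic to) $G$. For a graph $G$ without isolated vertices, $SIG_\infty(G)$ is the minimum positive integer $d$ such that $G$ has a $d$-dimensional SIG representation under the $L_\infty$ metric (such a $d$ always exists). *)

theory Defs
  imports
    Complex_Main
    "HOL-Library.FuncSet"
    "Graph_Theory.Graph_Theory"
begin

text \<open>
  Finite simple graphs are the \<^locale>\<open>pair_graph\<close>s of the AFP entry Graph_Theory: finite,
  loop-free, symmetric sets of arcs, an edge being a pair of opposite arcs.  The predicate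
  \<^const>\<open>Digraph_Component.tree\<close> of that entry does not describe undirected trees in this
  encoding, because an edge traversed back and forth counts as a directed cycle (of length 2);
  undirected cycles are the directed ones of length at least 3.
\<close>

definition undirected_tree :: "'a pair_pre_digraph \<Rightarrow> bool" where
  "undirected_tree T \<longleftrightarrow>
     pair_graph T \<and>
     Digraph_Component.connected (with_proj T) \<and>
     \<not> (\<exists>c. pre_digraph.cycle (with_proj T) c \<and> 3 \<le> length c)"


subsection \<open>Leaf-degrees\<close>

text \<open>In a symmetric digraph without parallel arcs the out-degree is the degree.\<close>

definition is_leaf :: "'a pair_pre_digraph \<Rightarrow> 'a \<Rightarrow> bool" where
  "is_leaf T v \<longleftrightarrow> v \<in> pverts T \<and> out_degree (with_proj T) v = 1"

definition leaf_neighbors :: "'a pair_pre_digraph \<Rightarrow> 'a \<Rightarrow> 'a set" where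
  "leaf_neighbors T x = {y. (x, y) \<in> parcs T \<and> is_leaf T y}"

definition leaf_alpha :: "'a pair_pre_digraph \<Rightarrow> nat" where
  "leaf_alpha T = (MAX x\<in>pverts T. card (leaf_neighbors T x))"

definition max_leaf_vertices :: "'a pair_pre_digraph \<Rightarrow> 'a set" where
  "max_leaf_vertices T = {v \<in> pverts T. card (leaf_neighbors T v) = leaf_alpha T}"

text \<open>
  For a tree with at least two vertices \<^const>\<open>max_leaf_vertices\<close> is nonempty and
  \<^const>\<open>leaf_alpha\<close> is positive, so the second case is that of exactly one such vertex
  and the subtraction does not truncate.
\<close>

definition leaf_beta :: "'a pair_pre_digraph \<Rightarrow> nat" where
  "leaf_beta T =
     (if 2 \<le> card (max_leaf_vertices T) then leaf_alpha T else leaf_alpha T - 1)"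


subsection \<open>Sphere-of-influence graphs\<close>

text \<open>
  Since the dimension varies, points of \<open>d\<close>-dimensional real space are the functions on
  \<open>{1..d}\<close> (extended by \<^const>\<open>undefined\<close> elsewhere).  The maxima below are used for \<open>d \<ge> 1\<close> only.
\<close>

definition real_space :: "nat \<Rightarrow> (nat \<Rightarrow> real) set" where
  "real_space d = {1..d} \<rightarrow>\<^sub>E UNIV"

definition linf_dist :: "nat \<Rightarrow> (nat \<Rightarrow> real) \<Rightarrow> (nat \<Rightarrow> real) \<Rightarrow> real" where
  "linf_dist d x y = (MAX i\<in>{1..d}. \<bar>x i - y i\<bar>)"

definition linf_ball :: "nat \<Rightarrow> (nat \<Rightarrow> real) \<Rightarrow> real \<Rightarrow> (nat \<Rightarrow> real) set" where
  "linf_ball d p r = {x \<in> real_space d. linf_dist d x p < r}"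

definition nn_radius :: "nat \<Rightarrow> (nat \<Rightarrow> real) set \<Rightarrow> (nat \<Rightarrow> real) \<Rightarrow> real" where
  "nn_radius d P p = (MIN q\<in>P - {p}. linf_dist d p q)"

definition sig_graph :: "nat \<Rightarrow> (nat \<Rightarrow> real) set \<Rightarrow> (nat \<Rightarrow> real) pair_pre_digraph" where
  "sig_graph d P =
     \<lparr> pverts = P,
       parcs = {(p, q). p \<in> P \<and> q \<in> P \<and> p \<noteq> q \<and>
                  linf_ball d p (nn_radius d P p) \<inter> linf_ball d q (nn_radius d P q) \<noteq> {}} \<rparr>"

definition is_sig_representation ::
    "nat \<Rightarrow> (nat \<Rightarrow> real) set \<Rightarrow> 'a pair_pre_digraph \<Rightarrow> bool" where
  "is_sig_representation d P G \<longleftrightarrow>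
     finite P \<and> 2 \<le> card P \<and> P \<subseteq> real_space d \<and>
     digraph_iso (with_proj G) (with_proj (sig_graph d P))"

definition SIG_inf :: "'a pair_pre_digraph \<Rightarrow> nat" where
  "SIG_inf G = (LEAST d. 1 \<le> d \<and> (\<exists>P. is_sig_representation d P G))"

end

(*
  Lower bound.  The nearest neighbour of a leaf p is its only neighbour v, so r_p = rho(p,v) >= r_v.
  Hence two leaves at v, or a leaf and any other neighbour of v, must lie strictly on opposite sides
  of v in some coordinate, and so in different orthants at v: the leaves at v together with one
  further neighbour number at most 2^d.

  Upper bound.  If beta + 2 <= 2^d, root the tree at a vertex with the most leaf neighbours and place
  branches bottom-up.  The leaf children of v are put at corners of the unit cube around v, leaving
  free the orthant of the other children and, if v is not the root, a second orthant on the side of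
  the parent; the branches of the remaining children are scaled down and attached to the surface of
  the unit ball inside the first free orthant.

  Sharpness.  The star with 2^k leaves has dimension k.  If a centre w has 2^k + 1 neighbours with
  2^k - 1 leaves each, then in dimension k each of these neighbours differs from w by at least r_w
  and by less than r_w plus its own radius in every coordinate; two of them lie in the same orthant
  at w, and their balls would meet.
*)
theory Submission
  imports Defs
begin

section \<open>Balls in the maximum metric\<close>

text \<open>Leaf children and other children cost differently. The radius of a leaf is tied to its
  distance from \<open>v\<close>, so every leaf uses up an orthant. A child with children of its own
  can have a tiny radius, attained inside its branch, so any number of such children fit into one
  orthant; their number is not bounded in terms of \<beta>, and this is why branches are scaled
  down. The obstacle is the ball of the parent: at the scale of a small branch it fills a whole
  region, which everything in the branch except its root must avoid, and gluing has to reproduce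
  this property one level up. This costs a second orthant at every vertex but the root. The leaf
  budgets are therefore 2^d - 1 at the root and 2^d - 2 elsewhere, which fits the definition of
  \<beta>: it is \<alpha> - 1 exactly when a single vertex, the root, needs the larger budget. The
  necessary condition \<beta> + 1 \<le> 2^d and the sufficient one \<beta> + 2 \<le> 2^d disagree
  only if \<beta> + 1 is a power of two. The sharpness examples show that in this case \<beta> alone
  does not decide the dimension.\<close>

lemma linf_dist_less_iff:
  assumes "1 \<le> d"
  shows "linf_dist d x y < a \<longleftrightarrow> (\<forall>i\<in>{1..d}. \<bar>x i - y i\<bar> < a)"
  using assms by (auto simp: linf_dist_def)

lemma linf_dist_le_iff:
  assumes "1 \<le> d"
  shows "linf_dist d x y \<le> a \<longleftrightarrow> (\<forall>i\<in>{1..d}. \<bar>x i - y i\<bar> \<le> a)"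
  using assms by (auto simp: linf_dist_def)

lemma le_linf_dist_iff:
  assumes "1 \<le> d"
  shows "a \<le> linf_dist d x y \<longleftrightarrow> (\<exists>i\<in>{1..d}. a \<le> \<bar>x i - y i\<bar>)"
  using linf_dist_less_iff[OF assms, of x y a] by (auto simp: not_less[symmetric])

text \<open>One direction is the triangle inequality in each coordinate; for the other, the point
  dividing the segment from \<open>p\<close> to \<open>q\<close> in the ratio \<open>a : b\<close>
  lies in both balls. Adjacency thus becomes a condition on distances and radii only.\<close>

lemma linf_balls_meet_iff:
  assumes d: "1 \<le> d" and p: "p \<in> real_space d" and q: "q \<in> real_space d"
    and a: "0 < a" and b: "0 < b"
  shows "linf_ball d p a \<inter> linf_ball d q b \<noteq> {} \<longleftrightarrow> linf_dist d p q < a + b"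
proof
  assume "linf_ball d p a \<inter> linf_ball d q b \<noteq> {}"
  then obtain x where "linf_dist d x p < a" "linf_dist d x q < b"
    by (auto simp: linf_ball_def)
  then show "linf_dist d p q < a + b"
    unfolding linf_dist_less_iff[OF d] by fastforce
next
  assume h: "linf_dist d p q < a + b"
  define x where "x = restrict (\<lambda>i. p i + a / (a + b) * (q i - p i)) {1..d}"
  have xp: "\<bar>x i - p i\<bar> < a" and xq: "\<bar>x i - q i\<bar> < b" if i: "i \<in> {1..d}" for i
  proof -
    define u where "u = (q i - p i) / (a + b)"
    have "\<bar>q i - p i\<bar> < a + b"
      using h i unfolding linf_dist_less_iff[OF d] by (simp add: abs_minus_commute)
    then have u: "\<bar>u\<bar> < 1"
      using a b by (simp add: u_def)
    have "x i - p i = a * u" "x i - q i = - (b * u)"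
      using i a b by (auto simp: x_def u_def field_simps)
    then show "\<bar>x i - p i\<bar> < a" "\<bar>x i - q i\<bar> < b"
      using u a b by (simp_all add: abs_mult)
  qed
  have "x \<in> real_space d"
    by (auto simp: x_def real_space_def)
  with xp xq have "x \<in> linf_ball d p a \<inter> linf_ball d q b"
    by (simp add: linf_ball_def linf_dist_less_iff[OF d])
  then show "linf_ball d p a \<inter> linf_ball d q b \<noteq> {}"
    by blast
qed

section \<open>Layouts\<close>

text \<open>
  Coordinatewise form of being a sphere-of-influence representation: \<^term>\<open>f\<close> places the vertices
  and \<^term>\<open>r\<close> is forced to be the nearest-neighbour distance, as each \<^term>\<open>r x\<close> is a lower
  bound for all distances from \<^term>\<open>x\<close> and is attained.
\<close>

definition edge_compatible ::
    "nat \<Rightarrow> 'a rel \<Rightarrow> ('a \<Rightarrow> nat \<Rightarrow> real) \<Rightarrow> ('a \<Rightarrow> real) \<Rightarrow> 'a \<Rightarrow> 'a \<Rightarrow> bool" where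
  "edge_compatible d A f r x y \<longleftrightarrow>
     (if (x, y) \<in> A
      then (\<forall>i\<in>{1..d}. \<bar>f x i - f y i\<bar> < r x + r y) \<and>
           (\<exists>i\<in>{1..d}. r x \<le> \<bar>f x i - f y i\<bar> \<and> r y \<le> \<bar>f x i - f y i\<bar>)
      else \<exists>i\<in>{1..d}. r x + r y \<le> \<bar>f x i - f y i\<bar>)"

definition sig_layout ::
    "nat \<Rightarrow> 'a rel \<Rightarrow> ('a \<Rightarrow> nat \<Rightarrow> real) \<Rightarrow> ('a \<Rightarrow> real) \<Rightarrow> 'a set \<Rightarrow> bool" where
  "sig_layout d A f r V \<longleftrightarrow>
     (\<forall>x\<in>V. 0 < r x \<and> (\<exists>y\<in>V. y \<noteq> x \<and> (\<forall>i\<in>{1..d}. \<bar>f x i - f y i\<bar> \<le> r x))) \<and>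
     (\<forall>x\<in>V. \<forall>y\<in>V. x \<noteq> y \<longrightarrow> edge_compatible d A f r x y)"

text \<open>The bound 2 confines all balls of a branch to a cube of known size, so scaled copies can
  be separated by the positions of their roots alone. Gluing restores the bound: balls of radius 1
  at the corners reach exactly 2, the shrunken branches less.\<close>

definition branch_layout ::
    "nat \<Rightarrow> 'a rel \<Rightarrow> 'a \<Rightarrow> ('a \<Rightarrow> nat \<Rightarrow> real) \<Rightarrow> ('a \<Rightarrow> real) \<Rightarrow> 'a set \<Rightarrow> bool" where
  "branch_layout d A v f r V \<longleftrightarrow>
     sig_layout d A f r V \<and> v \<in> V \<and> (\<forall>i\<in>{1..d}. f v i = 0) \<and> r v = 1 \<and>
     (\<forall>x\<in>V. \<forall>i\<in>{1..d}. \<bar>f x i\<bar> + r x \<le> 2)"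

text \<open>
  The ball of the parent of \<^term>\<open>v\<close>, seen at the scale of \<^term>\<open>v\<close>, is huge and lies on the
  negative side.  Its part near \<^term>\<open>v\<close> will either be \<open>{x. \<forall>i. x i < 0}\<close> or
  \<open>{x. \<forall>i\<ge>2. x i < -1/2}\<close>, up to isometry, and the branch of \<^term>\<open>v\<close>
  without \<^term>\<open>v\<close> itself has to stay outside both regions.
\<close>

definition escaping ::
    "nat \<Rightarrow> 'a \<Rightarrow> ('a \<Rightarrow> nat \<Rightarrow> real) \<Rightarrow> ('a \<Rightarrow> real) \<Rightarrow> 'a set \<Rightarrow> bool" where
  "escaping d v f r V \<longleftrightarrow>
     (\<forall>x\<in>V - {v}. (\<exists>i\<in>{1..d}. r x \<le> f x i) \<and> (\<exists>i\<in>{2..d}. r x - 1 / 2 \<le> f x i))"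

section \<open>Invariance of layouts under scaling, reflection and permutation of
  coordinates\<close>

lemma edge_compatible_sym:
  assumes "sym A" shows "edge_compatible d A f r x y \<longleftrightarrow> edge_compatible d A f r y x"
proof -
  have "(x, y) \<in> A \<longleftrightarrow> (y, x) \<in> A" using assms by (auto dest: symD)
  then show ?thesis
    unfolding edge_compatible_def by (simp add: abs_minus_commute add.commute conj_commute)
qed

text \<open>Formulated with absolute differences, so that translations and reflections need no
  parameters of their own; \<pi> accounts for the swap of two coordinates when a branch is
  attached.\<close>

lemma edge_compatible_similar:
  fixes f f' :: "'a \<Rightarrow> nat \<Rightarrow> real"
  assumes s: "0 < s" and pi: "bij_betw \<pi> {1..d} {1..d}"
    and f': "\<And>i. i \<in> {1..d} \<Longrightarrow> \<bar>f' x i - f' y i\<bar> = s * \<bar>f x (\<pi> i) - f y (\<pi> i)\<bar>"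
    and r': "r' x = s * r x" "r' y = s * r y"
  shows "edge_compatible d A f' r' x y \<longleftrightarrow> edge_compatible d A f r x y"
proof -
  have im: "{1..d} = \<pi> ` {1..d}" using pi by (simp add: bij_betw_def)
  have "(\<forall>i\<in>{1..d}. \<bar>f x i - f y i\<bar> < r x + r y) \<longleftrightarrow> (\<forall>i\<in>{1..d}. \<bar>f x (\<pi> i) - f y (\<pi> i)\<bar> < r x + r y)"
    by (subst im) blast
  moreover have "(\<exists>i\<in>{1..d}. r x + r y \<le> \<bar>f x i - f y i\<bar>) \<longleftrightarrow> (\<exists>i\<in>{1..d}. r x + r y \<le> \<bar>f x (\<pi> i) - f y (\<pi> i)\<bar>)"
    by (subst im) blast
  moreover have "(\<exists>i\<in>{1..d}. r x \<le> \<bar>f x i - f y i\<bar> \<and> r y \<le> \<bar>f x i - f y i\<bar>) \<longleftrightarrow>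
     (\<exists>i\<in>{1..d}. r x \<le> \<bar>f x (\<pi> i) - f y (\<pi> i)\<bar> \<and> r y \<le> \<bar>f x (\<pi> i) - f y (\<pi> i)\<bar>)"
    by (subst im) blast
  ultimately show ?thesis
    unfolding edge_compatible_def using s f' r' by (simp flip: distrib_left)
qed

lemma touches_similar:
  fixes f f' :: "'a \<Rightarrow> nat \<Rightarrow> real"
  assumes s: "0 < s" and pi: "bij_betw \<pi> {1..d} {1..d}"
    and f': "\<And>i. i \<in> {1..d} \<Longrightarrow> \<bar>f' x i - f' y i\<bar> = s * \<bar>f x (\<pi> i) - f y (\<pi> i)\<bar>"
    and r': "r' x = s * r x"
    and h: "\<forall>i\<in>{1..d}. \<bar>f x i - f y i\<bar> \<le> r x"
  shows "\<forall>i\<in>{1..d}. \<bar>f' x i - f' y i\<bar> \<le> r' x"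
proof
  fix i assume i: "i \<in> {1..d}"
  then have "\<pi> i \<in> {1..d}" using pi by (auto simp: bij_betw_def)
  then have "s * \<bar>f x (\<pi> i) - f y (\<pi> i)\<bar> \<le> s * r x"
    using h s by (intro mult_left_mono) auto
  then show "\<bar>f' x i - f' y i\<bar> \<le> r' x" using f'[OF i] r' by simp
qed

lemma far_imp_edge_compatible:
  "(x, y) \<notin> A \<Longrightarrow> i \<in> {1..d} \<Longrightarrow> r x + r y \<le> \<bar>f x i - f y i\<bar> \<Longrightarrow> edge_compatible d A f r x y"
  by (auto simp: edge_compatible_def)

text \<open>The geometric induction step, detached from trees: \<open>L\<close> are the leaf
  children, \<open>N\<close> the roots of finished branches. \<open>eps_free\<close> reserves the
  orthant (+,-,...,-) for the branches. Escaping is a conditional conclusion because it forbids the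
  corner (-,-,...,-) as well, which the root of the whole tree may use.\<close>

lemma branch_compose:
  fixes A :: "'a rel" and F :: "'a \<Rightarrow> 'a \<Rightarrow> nat \<Rightarrow> real" and \<epsilon> :: "'a \<Rightarrow> nat \<Rightarrow> real"
  assumes d: "2 \<le> d" and symA: "sym A" and fin: "finite N" and ne: "L \<union> N \<noteq> {}"
    and sub: "\<And>w. w \<in> N \<Longrightarrow> branch_layout d A w (F w) (R w) (B w) \<and> escaping d w (F w) (R w) (B w)"
    and vL: "v \<notin> L" and vB: "\<And>w. w \<in> N \<Longrightarrow> v \<notin> B w" and LB: "\<And>w. w \<in> N \<Longrightarrow> L \<inter> B w = {}"
    and BB: "\<And>w w'. w \<in> N \<Longrightarrow> w' \<in> N \<Longrightarrow> w \<noteq> w' \<Longrightarrow> B w \<inter> B w' = {}"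
    and A_vL: "\<And>l. l \<in> L \<Longrightarrow> (v, l) \<in> A"
    and A_LL: "\<And>l l'. l \<in> L \<Longrightarrow> l' \<in> L \<Longrightarrow> (l, l') \<notin> A"
    and A_vB: "\<And>w x. w \<in> N \<Longrightarrow> x \<in> B w \<Longrightarrow> (v, x) \<in> A \<longleftrightarrow> x = w"
    and A_LB: "\<And>w l x. w \<in> N \<Longrightarrow> x \<in> B w \<Longrightarrow> l \<in> L \<Longrightarrow> (l, x) \<notin> A"
    and A_BB: "\<And>w w' x y. w \<in> N \<Longrightarrow> w' \<in> N \<Longrightarrow> w \<noteq> w' \<Longrightarrow> x \<in> B w \<Longrightarrow> y \<in> B w' \<Longrightarrow> (x, y) \<notin> A"
    and eps: "\<And>l i. l \<in> L \<Longrightarrow> i \<in> {1..d} \<Longrightarrow> \<epsilon> l i = 1 \<or> \<epsilon> l i = -1"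
    and eps_inj: "\<And>l l'. l \<in> L \<Longrightarrow> l' \<in> L \<Longrightarrow> l \<noteq> l' \<Longrightarrow> \<exists>i\<in>{1..d}. \<epsilon> l i \<noteq> \<epsilon> l' i"
    and eps_free: "\<And>l. l \<in> L \<Longrightarrow> \<epsilon> l 1 = -1 \<or> (\<exists>i\<in>{2..d}. \<epsilon> l i = 1)"
  shows "\<exists>f r. branch_layout d A v f r ({v} \<union> L \<union> (\<Union>w\<in>N. B w)) \<and>
    ((\<forall>l\<in>L. \<exists>i\<in>{2..d}. \<epsilon> l i = 1) \<longrightarrow> escaping d v f r ({v} \<union> L \<union> (\<Union>w\<in>N. B w)))"
proof -
  define V where "V = {v} \<union> L \<union> (\<Union>w\<in>N. B w)"
  define n where "n = card N"
  obtain m where m: "bij_betw m N {..<n}"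
    using ex_bij_betw_finite_nat[OF fin] by (auto simp: n_def atLeast0LessThan)
  \<comment> \<open>A scaled branch has half-width \<open>2 * s\<close>, so positions
    \<open>c w\<close> at multiples of \<open>4 * s\<close> keep the branches apart. The factor 16
    makes \<open>c w\<close> at most 1/4 and the half-width at most 1/8, so the whole stack stays
    above -1/2 in coordinate 2.\<close>
  define s :: real where "s = 1 / (16 * (real n + 1))"
  define c where "c w = 4 * s * (real (m w) + 1)" for w
  have s0: "0 < s" by (simp add: s_def)
  have s1: "s \<le> 1 / 16" by (simp add: s_def field_simps)
  have c_lo: "4 * s \<le> c w" for w using s0 by (simp add: c_def)
  have c_hi: "c w \<le> 1 / 4" if "w \<in> N" for w
  proof -
    have "m w < n" using m that by (auto simp: bij_betw_def)
    then have "real (m w) + 1 \<le> real n + 1" by simp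
    then have "4 * s * (real (m w) + 1) \<le> 4 * s * (real n + 1)" using s0 by simp
    also have "\<dots> = 1 / 4" by (simp add: s_def field_simps)
    finally show ?thesis by (simp add: c_def)
  qed
  have c_gap: "4 * s \<le> \<bar>c w - c w'\<bar>" if "w \<in> N" "w' \<in> N" "w \<noteq> w'" for w w'
  proof -
    have "m w \<noteq> m w'" using m that by (auto simp: bij_betw_def inj_on_def)
    then have "1 \<le> \<bar>real (m w) - real (m w')\<bar>" by linarith
    then have "4 * s * 1 \<le> 4 * s * \<bar>real (m w) - real (m w')\<bar>" using s0 by (intro mult_left_mono) auto
    also have "\<dots> = \<bar>c w - c w'\<bar>" using s0 by (simp add: c_def abs_mult flip: right_diff_distrib)
    finally show ?thesis by simp
  qed
  \<comment> \<open>Without leaf children, one branch is put at distance exactly 1 to keep the radius of \<open>v\<close> equal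
    to 1; it lies in the all-positive orthant, so it cannot be used when leaf children fill that orthant.\<close>
  obtain S where S: "S = {} \<and> L \<noteq> {} \<or> (\<exists>w\<in>N. S = {w} \<and> L = {})"
    using ne by (cases "L = {}") auto
  have SN: "S \<subseteq> N" using S by auto
  \<comment> \<open>All other branches lie in the orthant \<open>(+,-,...,-)\<close>, slightly outside the unit ball of \<open>v\<close> in
    every coordinate but the second, along which they are stacked.  Swapping coordinates 1 and 2
    makes the next generation escape from the unit ball through that stacking coordinate.\<close>
  define emb :: "'a \<Rightarrow> (nat \<Rightarrow> real) \<Rightarrow> nat \<Rightarrow> real" where
    "emb w p = (if w \<in> S then (\<lambda>i. 1 + s * p i)
       else (\<lambda>i. if i = 1 then 1 + s / 2 + s * p 2 else if i = 2 then - c w + s * p 1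
                 else - (1 + s / 2) - s * p i))" for w p
  define br where "br x = (THE w. w \<in> N \<and> x \<in> B w)" for x
  have br: "br x = w" if "w \<in> N" "x \<in> B w" for x w
    unfolding br_def using that BB by blast
  define f where "f x = (if x = v then (\<lambda>i. 0) else if x \<in> L then \<epsilon> x else emb (br x) (F (br x) x))" for x
  define r where "r x = (if x = v \<or> x \<in> L then 1 else s * R (br x) x)" for x
  have fv: "f v i = 0" "r v = 1" for i by (auto simp: f_def r_def)
  have fL: "f l = \<epsilon> l" "r l = 1" if "l \<in> L" for l using that vL by (auto simp: f_def r_def)
  have fB: "f x = emb w (F w x)" "r x = s * R w x" if "w \<in> N" "x \<in> B w" for w x
    using that br[OF that] vB[OF that(1)] LB[OF that(1)] by (auto simp: f_def r_def)
  have d12: "1 \<in> {1..d}" "2 \<in> {1..d}" "2 \<in> {2..d}" using d by auto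
  have box: "s * \<bar>F w x i\<bar> + r x \<le> 2 * s" if "w \<in> N" "x \<in> B w" "i \<in> {1..d}" for w x i
  proof -
    have "\<bar>F w x i\<bar> + R w x \<le> 2"
      using sub[OF that(1)] that by (auto simp: branch_layout_def)
    then have "s * (\<bar>F w x i\<bar> + R w x) \<le> s * 2" using s0 by (intro mult_left_mono) auto
    then show ?thesis using fB[OF that(1,2)] by (simp add: distrib_left)
  qed
  have sR: "0 < R w x" if "w \<in> N" "x \<in> B w" for w x
    using sub[OF that(1)] that by (auto simp: branch_layout_def sig_layout_def)
  have rB: "0 < r x" if "w \<in> N" "x \<in> B w" for w x
    using sR[OF that] s0 fB[OF that] by simp
  have box': "\<bar>s * F w x i\<bar> \<le> 2 * s - r x" if "w \<in> N" "x \<in> B w" "i \<in> {1..d}" for w x i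
    using box[OF that] s0 by (simp add: abs_mult)
  have fw: "w \<in> B w" "F w w i = 0" "R w w = 1" if "w \<in> N" "i \<in> {1..d}" for w i
    using sub[OF that(1)] that by (auto simp: branch_layout_def)
  have fS: "f x i = 1 + s * F w x i" if "w \<in> S" "x \<in> B w" for w x i
    using that SN by (auto simp: fB emb_def)
  have f1: "f x 1 = 1 + s / 2 + s * F w x 2" and f2: "f x 2 = - c w + s * F w x 1"
    and f3: "\<And>i. 3 \<le> i \<Longrightarrow> f x i = - (1 + s / 2) - s * F w x i"
    if "w \<in> N - S" "x \<in> B w" for w x
    using that by (auto simp: fB emb_def)
  have esc1: "\<exists>i\<in>{1..d}. r x \<le> s * F w x i" and esc2: "\<exists>i\<in>{2..d}. r x - s / 2 \<le> s * F w x i"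
    if "w \<in> N" "x \<in> B w" "x \<noteq> w" for w x
  proof -
    have e: "(\<exists>i\<in>{1..d}. R w x \<le> F w x i) \<and> (\<exists>i\<in>{2..d}. R w x - 1/2 \<le> F w x i)"
      using sub[OF that(1)] that by (auto simp: escaping_def)
    have "s * R w x \<le> s * F w x i" if "R w x \<le> F w x i" for i using that s0 by simp
    then show "\<exists>i\<in>{1..d}. r x \<le> s * F w x i" using e fB[OF that(1,2)] by auto
    have "s * R w x - s / 2 \<le> s * F w x i" if "R w x - 1/2 \<le> F w x i" for i
      using mult_left_mono[OF that, of s] s0 by (simp add: right_diff_distrib)
    then show "\<exists>i\<in>{2..d}. r x - s / 2 \<le> s * F w x i" using e fB[OF that(1,2)] by auto
  qed
  define \<pi> :: "'a \<Rightarrow> nat \<Rightarrow> nat" where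
    "\<pi> w i = (if w \<in> S then i else if i = 1 then 2 else if i = 2 then 1 else i)" for w i
  have pi: "bij_betw (\<pi> w) {1..d} {1..d}" for w
    by (rule bij_betw_byWitness[where f' = "\<pi> w"]) (use d in \<open>auto simp: \<pi>_def\<close>)
  have sim: "\<bar>f x i - f y i\<bar> = s * \<bar>F w x (\<pi> w i) - F w y (\<pi> w i)\<bar>"
    if "w \<in> N" "x \<in> B w" "y \<in> B w" for w x y i
  proof -
    have "f x i - f y i = s * (F w x (\<pi> w i) - F w y (\<pi> w i)) \<or>
          f x i - f y i = - (s * (F w x (\<pi> w i) - F w y (\<pi> w i)))"
      using that by (auto simp: fB emb_def \<pi>_def algebra_simps)
    then show ?thesis using s0 by (auto simp: abs_mult)
  qed
  have touch: "\<exists>y\<in>V. y \<noteq> x \<and> (\<forall>i\<in>{1..d}. \<bar>f x i - f y i\<bar> \<le> r x)" and pos: "0 < r x" if x: "x \<in> V" for x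
  proof -
    consider "x = v" | "x \<in> L" | w where "w \<in> N" "x \<in> B w" using x by (auto simp: V_def)
    then show "\<exists>y\<in>V. y \<noteq> x \<and> (\<forall>i\<in>{1..d}. \<bar>f x i - f y i\<bar> \<le> r x)"
    proof cases
      case 1
      show ?thesis
      proof (cases "L = {}")
        case True
        then obtain w where w: "w \<in> N" "S = {w}" using S by auto
        with 1 fw[of w 1] d12 vB[OF w(1)] show ?thesis
          by (intro bexI[of _ w]) (auto simp: fv fS fw V_def)
      next
        case False
        then obtain l where l: "l \<in> L" by auto
        have "\<bar>\<epsilon> l i\<bar> \<le> 1" if "i \<in> {1..d}" for i using eps[OF l that] by auto
        with 1 l vL show ?thesis by (intro bexI[of _ l]) (auto simp: fv fL V_def)
      qed
    next
      case 2
      have "\<bar>\<epsilon> x i\<bar> \<le> 1" if "i \<in> {1..d}" for i using eps[OF 2 that] by auto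
      with 2 vL show ?thesis by (intro bexI[of _ v]) (auto simp: fv fL V_def)
    next
      case (3 w)
      then obtain y where y: "y \<in> B w" "y \<noteq> x" "\<forall>i\<in>{1..d}. \<bar>F w x i - F w y i\<bar> \<le> R w x"
        using sub[OF 3(1)] unfolding branch_layout_def sig_layout_def by meson
      have "\<forall>i\<in>{1..d}. \<bar>f x i - f y i\<bar> \<le> r x"
        by (rule touches_similar[where f = "F w" and r = "R w" and \<pi> = "\<pi> w", OF s0 pi])
          (use sim[OF 3 y(1)] fB(2)[OF 3] y(3) in auto)
      with y 3 show ?thesis by (auto simp: V_def)
    qed
    from x show "0 < r x" using rB by (auto simp: V_def fv fL)
  qed
  have comp_vL: "edge_compatible d A f r v l" if "l \<in> L" for l
  proof -
    have "\<bar>f v i - f l i\<bar> = 1" if "i \<in> {1..d}" for i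
      using eps[OF \<open>l \<in> L\<close> that] by (auto simp: fv fL \<open>l \<in> L\<close>)
    with A_vL[OF that] d12(1) show ?thesis by (auto simp: edge_compatible_def fv fL that)
  qed
  have comp_LL: "edge_compatible d A f r l l'" if l: "l \<in> L" "l' \<in> L" "l \<noteq> l'" for l l'
  proof -
    obtain i where i: "i \<in> {1..d}" "\<epsilon> l i \<noteq> \<epsilon> l' i" using eps_inj[OF l] by auto
    then have "\<bar>\<epsilon> l i - \<epsilon> l' i\<bar> = 2" using eps[OF l(1) i(1)] eps[OF l(2) i(1)] by auto
    with i A_LL[OF l(1,2)] show ?thesis
      by (intro far_imp_edge_compatible[where i = i]) (auto simp: fL l)
  qed
  have comp_vB: "edge_compatible d A f r v x" if w: "w \<in> N" "x \<in> B w" for w x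
  proof (cases "x = w")
    case True
    \<comment> \<open>The offset \<open>s / 2\<close> is a compromise: below the radius
      \<open>s\<close> of \<open>w\<close>, so that the balls of \<open>v\<close> and
      \<open>w\<close> meet, yet positive, so that in the coordinates of the branch the ball of
      \<open>v\<close> ends at -1/2 and leaves room for the next stack, which lies slightly below
      0.\<close>
    have *: "\<bar>f w i\<bar> < 1 + s" if i: "i \<in> {1..d}" for i
    proof (cases "w \<in> S")
      case True
      with fS[OF True fw(1)[OF w(1) i]] fw(2)[OF w(1) i] s0 show ?thesis by simp
    next
      case False
      then have wS: "w \<in> N - S" using w by auto
      consider "i = 1" | "i = 2" | "3 \<le> i" using i by force
      then show ?thesis
        using f1[OF wS fw(1)[OF w(1) i]] f2[OF wS fw(1)[OF w(1) i]] f3[OF wS fw(1)[OF w(1) i], of i]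
          fw(2)[OF w(1) i] fw(2)[OF w(1) d12(1)] fw(2)[OF w(1) d12(2)] s0 c_hi[OF w(1)] c_lo[of w]
        by cases auto
    qed
    have "1 \<le> \<bar>f w 1\<bar>"
      using fS[OF _ fw(1)[OF w(1) d12(1)], of 1] f1[OF _ fw(1)[OF w(1) d12(1)]]
        fw(2)[OF w(1) d12(1)] fw(2)[OF w(1) d12(2)] s0 w(1) by (cases "w \<in> S") auto
    moreover have "r w = s" using fB(2)[OF w(1) fw(1)[OF w(1) d12(1)]] fw(3)[OF w(1) d12(1)] by simp
    ultimately show ?thesis
      using * True A_vB[OF w] s1 d12(1) unfolding edge_compatible_def
      by (auto simp: fv intro!: bexI[of _ 1])
  next
    case False
    then have nA: "(v, x) \<notin> A" using A_vB[OF w] by simp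
    show ?thesis
    proof (cases "w \<in> S")
      case True
      obtain i where "i \<in> {1..d}" "r x \<le> s * F w x i" using esc1[OF w False] by auto
      with nA show ?thesis
        by (intro far_imp_edge_compatible[where i = i]) (auto simp: fv fS[OF True w(2)])
    next
      case F: False
      then have wS: "w \<in> N - S" using w by auto
      obtain i where i: "i \<in> {2..d}" "r x - s / 2 \<le> s * F w x i" using esc2[OF w False] by auto
      show ?thesis
      \<comment> \<open>Coordinate 2 of the branch has become coordinate 1. In either case the
        offset \<open>s / 2\<close> makes up for the deficit in \<open>esc2\<close>.\<close>
      proof (cases "i = 2")
        case True
        with nA i f1[OF wS w(2)] d12 show ?thesis
          by (intro far_imp_edge_compatible[where i = 1]) (auto simp: fv)
      next
        case False
        with nA i f3[OF wS w(2), of i] d12 show ?thesis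
          by (intro far_imp_edge_compatible[where i = i]) (auto simp: fv)
      qed
    qed
  qed
  have comp_LB: "edge_compatible d A f r l x" if l: "l \<in> L" and w: "w \<in> N" "x \<in> B w" for l w x
  proof -
    \<comment> \<open>With a leaf child present, all branches lie in the orthant (+,-,...,-), and
      every leaf corner differs from it in the sign of some coordinate, which separates.\<close>
    have "S = {}" using S l by auto
    then have wS: "w \<in> N - S" using w by auto
    note nA = A_LB[OF w l]
    note b = box'[OF w d12(1)] box'[OF w d12(2)] rB[OF w]
    consider "\<epsilon> l 1 = -1" | i where "i \<in> {2..d}" "\<epsilon> l i = 1" using eps_free[OF l] by auto
    then show ?thesis
    proof cases
      case 1
      have "r l + r x \<le> \<bar>f l 1 - f x 1\<bar>"
        using f1[OF wS w(2)] 1 b s0 s1 by (simp add: fL l)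
      then show ?thesis using nA d12 by (intro far_imp_edge_compatible[where i = 1])
    next
      case (2 i)
      have i: "i \<in> {1..d}" using 2 by auto
      show ?thesis
      proof (cases "i = 2")
        case True
        have "r l + r x \<le> \<bar>f l 2 - f x 2\<bar>"
          using f2[OF wS w(2)] 2 True b s0 s1 c_lo[of w] by (simp add: fL l)
        then show ?thesis using nA d12 by (intro far_imp_edge_compatible[where i = 2])
      next
        case False
        then have "3 \<le> i" using 2 by auto
        then have "r l + r x \<le> \<bar>f l i - f x i\<bar>"
          using f3[OF wS w(2), of i] 2 box'[OF w i] s0 s1 c_lo[of w] by (simp add: fL l)
        then show ?thesis using nA i by (intro far_imp_edge_compatible[where i = i])
      qed
    qed
  qed
  have comp_BB: "edge_compatible d A f r x y" if w: "w \<in> N" "x \<in> B w" and w': "w' \<in> N" "y \<in> B w'" and xy: "x \<noteq> y"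
    for w w' x y
  proof (cases "w = w'")
    case True
    have "edge_compatible d A (F w) (R w) x y"
      using sub[OF w(1)] w w' True xy by (auto simp: branch_layout_def sig_layout_def)
    moreover have "edge_compatible d A f r x y \<longleftrightarrow> edge_compatible d A (F w) (R w) x y"
      using w w' True by (intro edge_compatible_similar[OF s0 pi[of w]] sim fB(2)) auto
    ultimately show ?thesis by simp
  next
    case False
    note nA = A_BB[OF w(1) w'(1) False w(2) w'(2)]
    note b = box'[OF w d12(1)] box'[OF w d12(2)] rB[OF w] box'[OF w' d12(1)] box'[OF w' d12(2)] rB[OF w']
    \<comment> \<open>At most one branch is outside the stack, and it sits near 1 in coordinate 2
      while the stack is negative there; hence coordinate 2 separates any two branches.\<close>
    have "\<not> (w \<in> S \<and> w' \<in> S)" using S False by auto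
    then consider "w \<in> S" "w' \<in> N - S" | "w' \<in> S" "w \<in> N - S" | "w \<in> N - S" "w' \<in> N - S"
      using w w' by auto
    then have "r x + r y \<le> \<bar>f x 2 - f y 2\<bar>"
    proof cases
      case 1 then show ?thesis
        using fS[OF 1(1) w(2), of 2] f2[OF 1(2) w'(2)] c_lo[of w'] b s0 s1 by simp
    next
      case 2 then show ?thesis
        using fS[OF 2(1) w'(2), of 2] f2[OF 2(2) w(2)] c_lo[of w] b s0 s1 by simp
    next
      case 3 then show ?thesis
        using f2[OF 3(1) w(2)] f2[OF 3(2) w'(2)] c_gap[OF w(1) w'(1) False] b by simp
    qed
    then show ?thesis using nA d12 by (intro far_imp_edge_compatible[where i = 2])
  qed
  have comp: "edge_compatible d A f r x y" if xy: "x \<in> V" "y \<in> V" "x \<noteq> y" for x y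
  proof -
    consider "x = v" | "x \<in> L" | w where "w \<in> N" "x \<in> B w" using xy by (auto simp: V_def)
    moreover consider "y = v" | "y \<in> L" | w' where "w' \<in> N" "y \<in> B w'" using xy by (auto simp: V_def)
    ultimately show ?thesis
      using xy(3) comp_vL comp_LL comp_vB comp_LB comp_BB edge_compatible_sym[OF symA, of d f r x y]
      by (metis)
  qed
  have boxV: "\<bar>f x i\<bar> + r x \<le> 2" if x: "x \<in> V" and i: "i \<in> {1..d}" for x i
  proof -
    consider "x = v" | "x \<in> L" | w where "w \<in> N" "x \<in> B w" using x by (auto simp: V_def)
    then show ?thesis
    proof cases
      case 1 then show ?thesis by (simp add: fv)
    next
      case 2 then show ?thesis using eps[OF 2 i] by (auto simp: fL)
    next
      case w: (3 w)
      note b = box'[OF w d12(1)] box'[OF w d12(2)] box'[OF w i] rB[OF w]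
      show ?thesis
      proof (cases "w \<in> S")
        case True
        then show ?thesis using fS[OF True w(2)] b s0 s1 by simp
      next
        case False
        then have wS: "w \<in> N - S" using w by auto
        consider "i = 1" | "i = 2" | "3 \<le> i" using i by force
        then show ?thesis
          using f1[OF wS w(2)] f2[OF wS w(2)] f3[OF wS w(2), of i] b s0 s1 c_hi[OF w(1)] c_lo[of w]
          by cases auto
      qed
    qed
  qed
  have escV: "escaping d v f r V" if free: "\<forall>l\<in>L. \<exists>i\<in>{2..d}. \<epsilon> l i = 1"
    unfolding escaping_def
  proof
    fix x assume "x \<in> V - {v}"
    then consider "x \<in> L" | w where "w \<in> N" "x \<in> B w" by (auto simp: V_def)
    then show "(\<exists>i\<in>{1..d}. r x \<le> f x i) \<and> (\<exists>i\<in>{2..d}. r x - 1 / 2 \<le> f x i)"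
    proof cases
      case 1
      then obtain i where "i \<in> {2..d}" "\<epsilon> x i = 1" using free by auto
      with 1 show ?thesis by (auto simp: fL intro!: bexI[of _ i])
    next
      case w: (2 w)
      note b = box'[OF w d12(1)] box'[OF w d12(2)] rB[OF w]
      have "r x \<le> f x 1 \<and> r x - 1 / 2 \<le> f x 2"
        using fS[OF _ w(2)] f1[OF _ w(2)] f2[OF _ w(2)] b s0 s1 c_hi[OF w(1)] c_lo[of w] w(1)
        by (cases "w \<in> S") auto
      then show ?thesis using d12 by blast
    qed
  qed
  have "branch_layout d A v f r V"
    unfolding branch_layout_def sig_layout_def
    using touch pos comp boxV fv by (auto simp: V_def)
  with escV show ?thesis unfolding V_def by blast
qed

section \<open>Sphere-of-influence representations as layouts\<close>

lemma digraph_iso_with_proj_iff: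
  assumes G: "pair_wf_digraph G"
  shows "digraph_iso (with_proj G) (with_proj H) \<longleftrightarrow>
    (\<exists>h. inj_on h (pverts G) \<and> pverts H = h ` pverts G \<and> parcs H = map_prod h h ` parcs G)"
proof
  interpret pair_wf_digraph G by (rule G)
  assume "digraph_iso (with_proj G) (with_proj H)"
  then obtain hom where iso: "pre_digraph.digraph_isomorphism (with_proj G) hom"
    and H: "with_proj H = app_iso hom (with_proj G)"
    by (auto simp: digraph_iso_def)
  define h where "h = iso_verts hom"
  have inj: "inj_on h (pverts G)" using iso by (simp add: digraph_isomorphism_def h_def)
  have V: "pverts H = h ` pverts G"
    using arg_cong[OF H, of verts] by (simp add: verts_app_iso h_def)
  \<comment> \<open>Heads and tails are projections on both sides, so the arc map of the isomorphism
    is determined by its vertex map.\<close>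
  have th: "iso_tail hom = fst" "iso_head hom = snd"
    using arg_cong[OF H, of tail] arg_cong[OF H, of head] by (simp_all add: tail_app_iso head_app_iso)
  have "iso_arcs hom a = map_prod h h a" if "a \<in> parcs G" for a
    using iso that th by (auto simp: digraph_isomorphism_def h_def prod_eq_iff)
  then have "parcs H = map_prod h h ` parcs G"
    using arg_cong[OF H, of arcs] by (auto simp: arcs_app_iso)
  with inj V show "\<exists>h. inj_on h (pverts G) \<and> pverts H = h ` pverts G \<and> parcs H = map_prod h h ` parcs G"
    by blast
next
  interpret pair_wf_digraph G by (rule G)
  assume "\<exists>h. inj_on h (pverts G) \<and> pverts H = h ` pverts G \<and> parcs H = map_prod h h ` parcs G"
  then obtain h where h: "inj_on h (pverts G)" "pverts H = h ` pverts G" "parcs H = map_prod h h ` parcs G"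
    by blast
  define hom :: "('a, 'a \<times> 'a, 'b, 'b \<times> 'b) digraph_isomorphism" where
    "hom = \<lparr>iso_verts = h, iso_arcs = map_prod h h, iso_head = snd, iso_tail = fst\<rparr>"
  have "inj_on (map_prod h h) (pverts G \<times> pverts G)"
    using h(1) by (intro map_prod_inj_on)
  then have "inj_on (map_prod h h) (parcs G)"
    by (rule inj_on_subset) (auto dest: wellformed')
  then have "digraph_isomorphism hom"
    using h(1) wf_digraph_wp_iff[of G] G by (auto simp: digraph_isomorphism_def hom_def)
  moreover have "with_proj H = app_iso hom (with_proj G)"
    using h by (simp add: app_iso_def hom_def with_proj_def)
  ultimately show "digraph_iso (with_proj G) (with_proj H)"
    by (auto simp: digraph_iso_def)
qed

lemma linf_dist_commute: "linf_dist d x y = linf_dist d y x"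
  by (simp add: linf_dist_def abs_minus_commute)

lemma linf_dist_pos:
  assumes "1 \<le> d" "x \<in> real_space d" "y \<in> real_space d" "x \<noteq> y"
  shows "0 < linf_dist d x y"
proof (rule ccontr)
  assume "\<not> 0 < linf_dist d x y"
  then have "\<forall>i\<in>{1..d}. \<bar>x i - y i\<bar> \<le> 0" using linf_dist_le_iff[OF assms(1)] by (simp add: not_less)
  then have "x = y" using assms(2,3) by (intro PiE_ext[where k = "{1..d}"]) (auto simp: real_space_def)
  with assms(4) show False by simp
qed

lemma edge_compatible_iff_dist:
  assumes "1 \<le> d"
  shows "edge_compatible d A f r x y \<longleftrightarrow>
    (if (x, y) \<in> A then max (r x) (r y) \<le> linf_dist d (f x) (f y) \<and> linf_dist d (f x) (f y) < r x + r y
     else r x + r y \<le> linf_dist d (f x) (f y))"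
  unfolding edge_compatible_def linf_dist_less_iff[OF assms] le_linf_dist_iff[OF assms] by auto

text \<open>Non-neighbours are at distance at least the sum of two positive radii, so only edges
  need a separate lower bound for each radius to be at most every distance; being attained, it is
  then the nearest-neighbour radius. Positive radii also keep distinct vertices at distinct
  points.\<close>

lemma sig_representation_iff_layout:
  assumes T: "pair_graph T" and d: "1 \<le> d" and card: "2 \<le> card (pverts T)"
  shows "(\<exists>P. is_sig_representation d P T) \<longleftrightarrow> (\<exists>f r. sig_layout d (parcs T) f r (pverts T))"
proof
  interpret pair_graph T by (rule T)
  assume "\<exists>P. is_sig_representation d P T"
  then obtain P where P: "finite P" "2 \<le> card P" "P \<subseteq> real_space d"
    and "digraph_iso (with_proj T) (with_proj (sig_graph d P))"
    by (auto simp: is_sig_representation_def)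
  then obtain h where h: "inj_on h (pverts T)" and Ph: "P = h ` pverts T"
    and Ah: "parcs (sig_graph d P) = map_prod h h ` parcs T"
    unfolding digraph_iso_with_proj_iff[OF pair_wf_digraph] by (auto simp: sig_graph_def)
  define r where "r x = nn_radius d P (h x)" for x
  have other: "P - {p} \<noteq> {}" for p
  proof
    assume "P - {p} = {}"
    then have "P \<subseteq> {p}" by blast
    then have "card P \<le> card {p}" by (intro card_mono) auto
    with P(2) show False by simp
  qed
  have r_le: "r x \<le> linf_dist d (h x) (h y)" if "x \<in> pverts T" "y \<in> pverts T" "x \<noteq> y" for x y
    unfolding r_def nn_radius_def using that h P(1) by (intro Min_le) (auto simp: Ph inj_on_def)
  have r_eq: "\<exists>y\<in>pverts T. y \<noteq> x \<and> r x = linf_dist d (h x) (h y)" for x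
  proof -
    have "r x \<in> linf_dist d (h x) ` (P - {h x})"
      unfolding r_def nn_radius_def using other P(1) by (intro Min_in) auto
    then show ?thesis by (auto simp: Ph)
  qed
  have r_pos: "0 < r x" if x: "x \<in> pverts T" for x
  proof -
    obtain y where "y \<in> pverts T" "y \<noteq> x" "r x = linf_dist d (h x) (h y)" using r_eq by blast
    with linf_dist_pos[OF d, of "h x" "h y"] x h P(3) show ?thesis by (auto simp: Ph inj_on_def)
  qed
  have adj: "(x, y) \<in> parcs T \<longleftrightarrow> linf_dist d (h x) (h y) < r x + r y"
    if xy: "x \<in> pverts T" "y \<in> pverts T" "x \<noteq> y" for x y
  proof -
    have "(x, y) \<in> parcs T" if m: "(h x, h y) \<in> map_prod h h ` parcs T"
    proof -
      obtain x' y' where e: "(x', y') \<in> parcs T" "h x = h x'" "h y = h y'" using m by auto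
      then have "x = x'" "y = y'" using wellformed'[OF e(1)] xy h by (auto dest: inj_onD)
      with e show ?thesis by simp
    qed
    then have "(x, y) \<in> parcs T \<longleftrightarrow> (h x, h y) \<in> map_prod h h ` parcs T"
      by force
    also have "\<dots> \<longleftrightarrow> linf_ball d (h x) (r x) \<inter> linf_ball d (h y) (r y) \<noteq> {}"
      using xy h by (auto simp: Ah[symmetric] sig_graph_def r_def Ph inj_on_def)
    also have "\<dots> \<longleftrightarrow> linf_dist d (h x) (h y) < r x + r y"
      using xy P(3) r_pos by (intro linf_balls_meet_iff[OF d]) (auto simp: Ph)
    finally show ?thesis .
  qed
  have "edge_compatible d (parcs T) h r x y" if xy: "x \<in> pverts T" "y \<in> pverts T" "x \<noteq> y" for x y
    using adj[OF xy] r_le[OF xy] r_le[OF xy(2,1)] xy linf_dist_commute[of d "h x" "h y"]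
    unfolding edge_compatible_iff_dist[OF d] by auto
  moreover have "\<exists>y\<in>pverts T. y \<noteq> x \<and> (\<forall>i\<in>{1..d}. \<bar>h x i - h y i\<bar> \<le> r x)" for x
    using r_eq[of x] by (metis linf_dist_le_iff[OF d] order_refl)
  ultimately show "\<exists>f r. sig_layout d (parcs T) f r (pverts T)"
    using r_pos unfolding sig_layout_def by blast
next
  interpret pair_graph T by (rule T)
  assume "\<exists>f r. sig_layout d (parcs T) f r (pverts T)"
  then obtain f r where lay: "sig_layout d (parcs T) f r (pverts T)" by blast
  \<comment> \<open>Points of \<open>real_space\<close> are \<open>undefined\<close> outside
    \<open>{1..d}\<close>, where \<open>f\<close> is arbitrary.\<close>
  define h where "h x = restrict (f x) {1..d}" for x
  define P where "P = h ` pverts T"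
  have dist: "linf_dist d (h x) (h y) = linf_dist d (f x) (f y)" for x y
    by (simp add: linf_dist_def h_def cong: image_cong_simp)
  have r_pos: "0 < r x" if "x \<in> pverts T" for x using lay that by (auto simp: sig_layout_def)
  have comp: "if (x, y) \<in> parcs T
      then max (r x) (r y) \<le> linf_dist d (h x) (h y) \<and> linf_dist d (h x) (h y) < r x + r y
      else r x + r y \<le> linf_dist d (h x) (h y)"
    if "x \<in> pverts T" "y \<in> pverts T" "x \<noteq> y" for x y
    using lay that unfolding sig_layout_def edge_compatible_iff_dist[OF d] dist by blast
  have r_le: "r x \<le> linf_dist d (h x) (h y)"
    if "x \<in> pverts T" "y \<in> pverts T" "x \<noteq> y" for x y
    using comp[OF that] r_pos that by (force split: if_splits)
  have inj: "inj_on h (pverts T)"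
  proof (rule inj_onI, rule ccontr)
    fix x y assume xy: "x \<in> pverts T" "y \<in> pverts T" "h x = h y" "x \<noteq> y"
    have "linf_dist d (h x) (h y) \<le> 0" using xy(3) by (simp add: linf_dist_le_iff[OF d])
    with r_le[OF xy(1,2,4)] r_pos[OF xy(1)] show False by simp
  qed
  have Ps: "P \<subseteq> real_space d" by (auto simp: P_def h_def real_space_def)
  have nn: "nn_radius d P (h x) = r x" if x: "x \<in> pverts T" for x
    unfolding nn_radius_def
  proof (rule Min_eqI)
    show "finite (linf_dist d (h x) ` (P - {h x}))" by (simp add: P_def)
    show "r x \<le> y" if "y \<in> linf_dist d (h x) ` (P - {h x})" for y
      using that x r_le by (auto simp: P_def)
    obtain y where y: "y \<in> pverts T" "y \<noteq> x" "\<forall>i\<in>{1..d}. \<bar>f x i - f y i\<bar> \<le> r x"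
      using lay x unfolding sig_layout_def by meson
    then have "linf_dist d (h x) (h y) \<le> r x" by (simp add: linf_dist_le_iff[OF d] dist)
    with r_le[of x y] x y have "r x = linf_dist d (h x) (h y)" by simp
    with inj x y show "r x \<in> linf_dist d (h x) ` (P - {h x})" by (auto simp: P_def inj_on_def)
  qed
  have meet: "linf_ball d (h x) (r x) \<inter> linf_ball d (h y) (r y) \<noteq> {} \<longleftrightarrow> (x, y) \<in> parcs T"
    if xy: "x \<in> pverts T" "y \<in> pverts T" "x \<noteq> y" for x y
    using linf_balls_meet_iff[OF d _ _ r_pos[OF xy(1)] r_pos[OF xy(2)], of "h x" "h y"] Ps xy comp[OF xy]
    by (auto simp: P_def split: if_splits)
  have arcs: "parcs (sig_graph d P) = map_prod h h ` parcs T"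
  proof (intro set_eqI iffI)
    fix a assume "a \<in> parcs (sig_graph d P)"
    then obtain x y where xy: "a = (h x, h y)" "x \<in> pverts T" "y \<in> pverts T" "h x \<noteq> h y"
      "linf_ball d (h x) (nn_radius d P (h x)) \<inter> linf_ball d (h y) (nn_radius d P (h y)) \<noteq> {}"
      by (auto simp: sig_graph_def P_def)
    then have "(x, y) \<in> parcs T" using meet[of x y] nn by auto
    then show "a \<in> map_prod h h ` parcs T" using xy(1) by force
  next
    fix a assume "a \<in> map_prod h h ` parcs T"
    then obtain x y where xy: "a = (h x, h y)" "(x, y) \<in> parcs T" by auto
    then have V: "x \<in> pverts T" "y \<in> pverts T" "x \<noteq> y" using wellformed' no_loops' by auto
    then have "h x \<noteq> h y" using inj by (auto simp: inj_on_def)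
    then show "a \<in> parcs (sig_graph d P)"
      using meet[OF V] V xy nn by (auto simp: sig_graph_def P_def)
  qed
  have "digraph_iso (with_proj T) (with_proj (sig_graph d P))"
    unfolding digraph_iso_with_proj_iff[OF pair_wf_digraph] using inj arcs
    by (intro exI[of _ h]) (simp add: P_def sig_graph_def)
  moreover have "card P = card (pverts T)" using inj by (simp add: P_def card_image)
  ultimately show "\<exists>P. is_sig_representation d P T"
    using Ps card unfolding is_sig_representation_def by (metis P_def finite_imageI pair_finite_verts)
qed

section \<open>Rooted trees\<close>

lemma finite_has_max_image:
  fixes g :: "'a \<Rightarrow> 'b::linorder"
  assumes "finite S" "S \<noteq> {}"
  shows "\<exists>x\<in>S. \<forall>y\<in>S. g y \<le> g x"
proof -
  have "Max (g ` S) \<in> g ` S" using assms by (intro Max_in) auto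
  then obtain x where "x \<in> S" "g x = Max (g ` S)" by auto
  with assms show ?thesis by (intro bexI[of _ x]) auto
qed

text \<open>Parent pointers with a depth function that excludes cycles among them. The format serves
  in both directions: an undirected tree can be rooted at any vertex for the induction, and explicit
  parent functions produce the extremal trees.\<close>

locale rooted_tree =
  fixes V :: "'a set" and A :: "'a rel" and root :: 'a and par :: "'a \<Rightarrow> 'a" and dp :: "'a \<Rightarrow> nat"
  assumes finite_V: "finite V" and root_in: "root \<in> V" and dp_root: "dp root = 0"
    and par_in: "\<And>x. x \<in> V \<Longrightarrow> x \<noteq> root \<Longrightarrow> par x \<in> V"
    and dp_par: "\<And>x. x \<in> V \<Longrightarrow> x \<noteq> root \<Longrightarrow> dp x = Suc (dp (par x))"
    and arc_iff: "\<And>x y. (x, y) \<in> A \<longleftrightarrow>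
      x \<in> V \<and> y \<in> V \<and> (x \<noteq> root \<and> y = par x \<or> y \<noteq> root \<and> x = par y)"

text \<open>Shortening the walk to a path adds no vertices, and \<open>p \<noteq> q\<close> leaves
  at least one arc; closing up through \<open>x\<close> adds two more, hence length at least
  3.\<close>

lemma (in pair_graph) walk_avoiding_imp_cycle:
  assumes walk: "awalk p \<pi> q" and avoid: "x \<notin> set (awalk_verts p \<pi>)" and "p \<noteq> q"
    and arcs: "(x, p) \<in> parcs G" "(q, x) \<in> parcs G"
  shows "\<exists>c. cycle c \<and> 3 \<le> length c"
proof -
  define \<rho> where "\<rho> = awalk_to_apath \<pi>"
  have \<rho>: "apath p \<rho> q" unfolding \<rho>_def by (rule apath_awalk_to_apath[OF walk])
  then have w\<rho>: "awalk p \<rho> q" by (simp add: apath_def)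
  have "\<rho> \<noteq> []" using w\<rho> \<open>p \<noteq> q\<close> by (auto simp: awalk_Nil_iff)
  have "set \<rho> \<subseteq> set \<pi>" unfolding \<rho>_def by (rule awalk_to_apath_subset[OF walk])
  then have "set (awalk_verts p \<rho>) \<subseteq> set (awalk_verts p \<pi>)"
    using set_awalk_verts[OF w\<rho>] set_awalk_verts[OF walk] by auto
  then have x: "x \<notin> set (awalk_verts p \<rho>)" using avoid by auto
  define c where "c = (x, p) # \<rho> @ [(q, x)]"
  have wq: "awalk p (\<rho> @ [(q, x)]) x"
    by (rule awalk_appendI[OF w\<rho>]) (use arcs in_arcsD2 in \<open>auto simp: awalk_simps\<close>)
  then have "awalk x c x"
    using arcs by (simp add: c_def awalk_Cons_iff del: awalk_append_iff)
  moreover have "awalk_verts p (\<rho> @ [(q, x)]) = awalk_verts p \<rho> @ [x]"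
    using awalk_verts_append[OF wq] by simp
  then have "distinct (tl (awalk_verts x c))"
    using \<rho> x by (simp add: c_def apath_def)
  moreover have "3 \<le> length c" using \<open>\<rho> \<noteq> []\<close> by (cases \<rho>) (auto simp: c_def)
  moreover have "c \<noteq> []" by (simp add: c_def)
  ultimately show ?thesis unfolding cycle_def by blast
qed

text \<open>Depth is the distance from \<open>r\<close>, and a parent is a neighbour one step
  closer. Acyclicity enters only through uniqueness: two neighbours of \<open>x\<close> no farther
  from \<open>r\<close> than \<open>x\<close> are joined via \<open>r\<close> by a walk avoiding
  \<open>x\<close>, and so lie on a cycle with \<open>x\<close>.\<close>

lemma undirected_tree_rooted:
  assumes T: "undirected_tree T" and r: "r \<in> pverts T"
  shows "\<exists>par dp. rooted_tree (pverts T) (parcs T) r par dp"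
proof -
  interpret pair_graph T using T by (simp add: undirected_tree_def)
  have conn: "connected (with_proj T)" and acyc: "\<not> (\<exists>c. cycle c \<and> 3 \<le> length c)"
    using T by (simp_all add: undirected_tree_def)
  define A where "A = parcs T"
  define dp where "dp x = (LEAST n. (r, x) \<in> A ^^ n)" for x
  have sc: "strongly_connected (with_proj T)"
    using symmetric_connected_imp_strongly_connected[OF sym_arcs conn] .
  have ex: "(r, x) \<in> A ^^ dp x" if "x \<in> pverts T" for x
  proof -
    have "(r, x) \<in> A\<^sup>*"
      using sc r that reachable_rtranclI[of "with_proj T"] by (auto simp: strongly_connected_def A_def)
    then obtain n where "(r, x) \<in> A ^^ n" by (auto simp: rtrancl_power)
    then show ?thesis unfolding dp_def by (rule LeastI)
  qed
  have le: "dp x \<le> n" if "(r, x) \<in> A ^^ n" for x n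
    unfolding dp_def using that by (rule Least_le)
  have dp_root: "dp r = 0" using le[of r 0] by simp
  have dp_step: "dp y \<le> Suc (dp x)" if "(x, y) \<in> A" for x y
    using le[of y "Suc (dp x)"] ex[of x] that in_arcsD1 by (auto simp: A_def)
  have parent: "\<exists>z. (x, z) \<in> A \<and> dp x = Suc (dp z)" if x: "x \<in> pverts T" "x \<noteq> r" for x
  proof -
    obtain n where n: "dp x = Suc n" using ex[OF x(1)] x(2) by (cases "dp x") auto
    then obtain z where z: "(r, z) \<in> A ^^ n" "(z, x) \<in> A" using ex[OF x(1)] by auto
    then have "dp z \<le> n" "dp x \<le> Suc (dp z)" using le dp_step by auto
    with z n show ?thesis using arcs_symmetric by (auto simp: A_def)
  qed
  \<comment> \<open>Descending along parents strictly lowers the depth, so after \<open>y\<close>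
    itself only vertices of smaller depth than \<open>x\<close> occur.\<close>
  have walk: "\<exists>\<pi>. awalk y \<pi> r \<and> x \<notin> set (awalk_verts y \<pi>)"
    if "y \<in> pverts T" "y \<noteq> x" "dp y \<le> dp x" for x y
    using that
  proof (induction "dp y" arbitrary: y)
    case 0
    then have "y = r" using parent by fastforce
    with 0 show ?case by (intro exI[of _ "[]"]) (auto simp: awalk_Nil_iff)
  next
    case (Suc n)
    then have "y \<noteq> r" using dp_root by auto
    then obtain z where z: "(y, z) \<in> A" "dp y = Suc (dp z)" using parent Suc.prems by blast
    then have "z \<noteq> x" using Suc.prems by auto
    with z obtain \<pi> where "awalk z \<pi> r" "x \<notin> set (awalk_verts z \<pi>)"
      using Suc.hyps(1)[of z] Suc.hyps(2) Suc.prems in_arcsD2 by (auto simp: A_def)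
    with z Suc.prems show ?case
      by (intro exI[of _ "(y, z) # \<pi>"]) (auto simp: awalk_Cons_iff A_def)
  qed
  \<comment> \<open>The weak inequalities also cover edges within one level.\<close>
  have uniq: "p = q" if pq: "(x, p) \<in> A" "(x, q) \<in> A" "dp p \<le> dp x" "dp q \<le> dp x" for x p q
  proof (rule ccontr)
    assume "p \<noteq> q"
    have V: "p \<in> pverts T" "q \<in> pverts T" "p \<noteq> x" "q \<noteq> x"
      using pq in_arcsD2 no_loops' by (auto simp: A_def)
    obtain \<pi> \<sigma> where "awalk p \<pi> r" "x \<notin> set (awalk_verts p \<pi>)"
      and \<sigma>: "awalk q \<sigma> r" "x \<notin> set (awalk_verts q \<sigma>)"
      using walk V pq by metis
    moreover have "awalk r (rev_path \<sigma>) q" "x \<notin> set (awalk_verts r (rev_path \<sigma>))"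
      using \<sigma> awalk_verts_rev_path[OF \<sigma>(1)] by auto
    ultimately have "awalk p (\<pi> @ rev_path \<sigma>) q" "x \<notin> set (awalk_verts p (\<pi> @ rev_path \<sigma>))"
      using set_awalk_verts_append[of p \<pi> r "rev_path \<sigma>" q] awalk_appendI by auto
    from walk_avoiding_imp_cycle[OF this \<open>p \<noteq> q\<close>] pq arcs_symmetric acyc show False
      by (auto simp: A_def)
  qed
  define par where "par x = (SOME z. (x, z) \<in> A \<and> dp x = Suc (dp z))" for x
  have par: "(x, par x) \<in> A" "dp x = Suc (dp (par x))" if "x \<in> pverts T" "x \<noteq> r" for x
    using someI_ex[OF parent[OF that]] by (auto simp: par_def)
  have "(x, y) \<in> parcs T \<longleftrightarrow>
      x \<in> pverts T \<and> y \<in> pverts T \<and> (x \<noteq> r \<and> y = par x \<or> y \<noteq> r \<and> x = par y)" for x y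
  proof
    assume xy: "(x, y) \<in> parcs T"
    then have V: "x \<in> pverts T" "y \<in> pverts T" and yx: "(y, x) \<in> A" and ne: "x \<noteq> y"
      using in_arcsD1 in_arcsD2 arcs_symmetric no_loops' by (auto simp: A_def)
    show "x \<in> pverts T \<and> y \<in> pverts T \<and> (x \<noteq> r \<and> y = par x \<or> y \<noteq> r \<and> x = par y)"
    proof (cases "dp y \<le> dp x")
      case True
      have "x \<noteq> r"
      proof
        assume "x = r"
        with True have "dp y = 0" by (simp add: dp_root)
        with par[OF V(2)] have "y = r" by auto
        with ne \<open>x = r\<close> show False by simp
      qed
      with True xy uniq[of x y "par x"] par[OF V(1)] V show ?thesis by (auto simp: A_def)
    next
      case False
      then have "y \<noteq> r" using dp_root by auto
      with False yx uniq[of y x "par y"] par[OF V(2)] V show ?thesis by (auto simp: A_def)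
    qed
  next
    assume "x \<in> pverts T \<and> y \<in> pverts T \<and> (x \<noteq> r \<and> y = par x \<or> y \<noteq> r \<and> x = par y)"
    then show "(x, y) \<in> parcs T" using par(1) arcs_symmetric by (auto simp: A_def)
  qed
  then have "rooted_tree (pverts T) (parcs T) r par dp"
    using par in_arcsD2 r dp_root pair_finite_verts unfolding A_def
    by (intro rooted_tree.intro) blast+
  then show ?thesis by blast
qed

context rooted_tree
begin

lemma sym_A: "sym A"
  by (auto simp: sym_def arc_iff)

lemma par_neq: "x \<in> V \<Longrightarrow> x \<noteq> root \<Longrightarrow> par x \<noteq> x"
  using dp_par by fastforce

lemma no_loop: "(x, x) \<notin> A"
  using par_neq by (metis arc_iff)

lemma pair_graph_rooted: "pair_graph \<lparr>pverts = V, parcs = A\<rparr>"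
proof
  show "finite (parcs \<lparr>pverts = V, parcs = A\<rparr>)"
    by (rule finite_subset[of _ "V \<times> V"]) (auto simp: finite_V arc_iff)
  show "symmetric (with_proj \<lparr>pverts = V, parcs = A\<rparr>)"
    by (simp add: symmetric_def sym_A)
  show "fst e \<noteq> snd e" if "e \<in> parcs \<lparr>pverts = V, parcs = A\<rparr>" for e
    using that no_loop by (cases e) auto
qed (auto simp: finite_V arc_iff)

text \<open>Both cyclic neighbours of a deepest vertex of a cycle are at most as deep, hence equal
  to its parent, whereas in a cycle of length at least 3 they are distinct. Connectedness comes from
  following parents to the root.\<close>

lemma undirected_tree_rooted_converse: "undirected_tree \<lparr>pverts = V, parcs = A\<rparr>"
proof -
  let ?T = "\<lparr>pverts = V, parcs = A\<rparr>"
  interpret T: pair_graph ?T by (rule pair_graph_rooted)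
  have to_root: "x \<rightarrow>\<^sup>*\<^bsub>with_proj ?T\<^esub> root" if "x \<in> V" for x
    using that
  proof (induction "dp x" arbitrary: x rule: less_induct)
    case less
    show ?case
    proof (cases "x = root")
      case True
      with less show ?thesis by (auto intro: T.reachable_refl)
    next
      case False
      then have "(x, par x) \<in> A" using less.prems par_in by (auto simp: arc_iff)
      moreover have "par x \<rightarrow>\<^sup>*\<^bsub>with_proj ?T\<^esub> root"
        using less False par_in dp_par by auto
      ultimately show ?thesis by (auto intro: T.adj_reachable_trans)
    qed
  qed
  have "x \<rightarrow>\<^sup>*\<^bsub>with_proj ?T\<^esub> y" if "x \<in> V" "y \<in> V" for x y
    using T.reachable_trans[OF to_root symmetric_reachable[OF _ to_root]] that T.sym_arcs by blast
  then have "connected (with_proj ?T)"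
    using root_in T.reachable_mk_symmetric_eq[OF T.sym_arcs]
    unfolding connected_def by (intro strongly_connectedI) auto
  moreover have "\<not> (\<exists>c. T.cycle c \<and> 3 \<le> length c)"
  proof
    assume "\<exists>c. T.cycle c \<and> 3 \<le> length c"
    then obtain c u where w: "T.awalk u c u" and dist: "distinct (tl (T.awalk_verts u c))"
      and n: "3 \<le> length c" by (auto simp: T.cycle_def)
    define n where "n = length c"
    have cA: "set c \<subseteq> A" and cas: "T.cas u c u" using w by (auto simp: T.awalk_def)
    have "c \<noteq> []" using n by auto
    then have dist: "distinct (map snd c)"
      using dist T.awalk_verts_conv'[OF cas] by simp
    have nxt: "snd (c ! j) = fst (c ! (if Suc j = n then 0 else Suc j))" if "j < n" for j
    proof -
      have step: "snd (c ! j) = fst (c ! Suc j)" if "pcas a c b" "Suc j < length c" for a b c j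
        using that
      proof (induction c arbitrary: a j)
        case (Cons e c) then show ?case by (cases c; cases j) auto
      qed simp
      have ends: "fst (hd c) = a \<and> snd (last c) = b" if "pcas a c b" "c \<noteq> []" for a b c
        using that by (induction a c b rule: pcas.induct) (auto split: if_splits elim: pcas.elims)
      show ?thesis
      proof (cases "Suc j = n")
        case True
        then have "j = length c - 1" by (simp add: n_def)
        then show ?thesis
          using ends[of u c u] cas \<open>c \<noteq> []\<close>
          unfolding if_P[OF True] by (simp add: hd_conv_nth last_conv_nth)
      next
        case False
        then show ?thesis using step[of u c u j] cas \<open>j < n\<close> by (simp add: n_def)
      qed
    qed
    have "0 \<in> {..<n}" using \<open>c \<noteq> []\<close> by (simp add: n_def)
    then have "{..<n} \<noteq> {}" by blast
    then obtain j where j: "j < n" and max: "\<And>k. k < n \<Longrightarrow> dp (snd (c ! k)) \<le> dp (snd (c ! j))"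
      using finite_has_max_image[of "{..<n}" "\<lambda>k. dp (snd (c ! k))"] by auto
    \<comment> \<open>The vertices of the cycle are indexed by the heads of its arcs, so
      \<open>k\<close> and \<open>i\<close> are the cyclic successor and predecessor of
      \<open>j\<close>.\<close>
    define k where "k = (if Suc j = n then 0 else Suc j)"
    define i where "i = (if j = 0 then n - 1 else j - 1)"
    have ik: "i < n" "k < n" "i \<noteq> k" using j n by (auto simp: i_def k_def n_def)
    have "snd (c ! i) = fst (c ! j)" using nxt[OF ik(1)] j n by (auto simp: i_def n_def split: if_splits)
    then have 1: "(snd (c ! i), snd (c ! j)) \<in> A" using cA j by (auto simp: n_def)
    have "snd (c ! j) = fst (c ! k)" using nxt[OF j] by (simp add: k_def)
    then have 2: "(snd (c ! j), snd (c ! k)) \<in> A" using cA ik by (auto simp: n_def)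
    have "snd (c ! i) = par (snd (c ! j))" "snd (c ! k) = par (snd (c ! j))"
      using 1 2 max[OF ik(1)] max[OF ik(2)] dp_par by (fastforce simp: arc_iff)+
    then have "map snd c ! i = map snd c ! k" using ik by (simp add: n_def)
    with nth_eq_iff_index_eq[OF dist, of i k] ik show False by (simp add: n_def)
  qed
  ultimately show ?thesis
    using pair_graph_rooted by (simp add: undirected_tree_def)
qed

section \<open>Subtrees below a vertex\<close>

definition children :: "'a \<Rightarrow> 'a set" where
  "children v = {w \<in> V. w \<noteq> root \<and> par w = v}"

text \<open>Fixing the number of parent steps by the depth avoids an existential quantifier over
  ancestors and makes the subtrees of siblings disjoint at once.\<close>

definition desc :: "'a \<Rightarrow> 'a set" where
  "desc v = {x \<in> V. dp v \<le> dp x \<and> (par ^^ (dp x - dp v)) x = v}"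

lemma ancestor:
  assumes "x \<in> V" "j \<le> dp x"
  shows "(par ^^ j) x \<in> V \<and> dp ((par ^^ j) x) = dp x - j"
  using assms(2)
proof (induction j)
  case (Suc j)
  then have "(par ^^ j) x \<in> V" "dp ((par ^^ j) x) = dp x - j" by auto
  moreover have "(par ^^ j) x \<noteq> root" using calculation Suc.prems dp_root by auto
  ultimately show ?case using par_in dp_par by fastforce
qed (use assms in simp)

lemma self_desc: "v \<in> V \<Longrightarrow> v \<in> desc v"
  by (simp add: desc_def)

lemma dp_desc: "x \<in> desc v \<Longrightarrow> x \<noteq> v \<Longrightarrow> dp v < dp x"
  by (cases "dp v = dp x") (auto simp: desc_def)

lemma par_desc:
  assumes "x \<in> desc v" "x \<noteq> v" shows "x \<noteq> root" "par x \<in> desc v"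
proof -
  have lt: "dp v < dp x" using dp_desc[OF assms] .
  then show r: "x \<noteq> root" using dp_root by auto
  have x: "x \<in> V" using assms by (simp add: desc_def)
  have "dp x - dp v = Suc (dp (par x) - dp v)" using dp_par[OF x r] lt by simp
  then have "(par ^^ (dp (par x) - dp v)) (par x) = v"
    using assms by (auto simp: desc_def funpow_swap1)
  then show "par x \<in> desc v" using par_in[OF x r] dp_par[OF x r] lt by (simp add: desc_def)
qed

lemma dp_children: "w \<in> children v \<Longrightarrow> dp w = Suc (dp v)"
  using dp_par by (auto simp: children_def)

lemma desc_eq:
  assumes "v \<in> V" shows "desc v = insert v (\<Union>w\<in>children v. desc w)"
proof (intro set_eqI iffI)
  fix x assume x: "x \<in> desc v"
  show "x \<in> insert v (\<Union>w\<in>children v. desc w)"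
  proof (cases "x = v")
    case False
    then obtain k where k: "dp x - dp v = Suc k" using dp_desc[OF x] by (metis Suc_diff_Suc)
    define w where "w = (par ^^ k) x"
    have xV: "x \<in> V" using x by (simp add: desc_def)
    have w: "w \<in> V" "dp w = dp x - k" using ancestor[OF xV, of k] k by (auto simp: w_def)
    have "par w = v" using x k by (simp add: desc_def w_def)
    moreover have "w \<noteq> root" using w k dp_root by auto
    ultimately have "w \<in> children v" using w by (simp add: children_def)
    moreover have "x \<in> desc w" using w k xV by (auto simp: desc_def w_def[symmetric])
    ultimately show ?thesis by blast
  qed simp
next
  fix x assume "x \<in> insert v (\<Union>w\<in>children v. desc w)"
  then consider "x = v" | w where "w \<in> children v" "x \<in> desc w" by blast
  then show "x \<in> desc v"
  proof cases
    case 2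
    then have "dp w = Suc (dp v)" "par w = v" "dp w \<le> dp x" "(par ^^ (dp x - dp w)) x = w" "x \<in> V"
      using dp_children by (auto simp: children_def desc_def)
    moreover then have "dp x - dp v = Suc (dp x - dp w)" by simp
    ultimately show ?thesis by (simp add: desc_def)
  qed (use assms self_desc in simp)
qed

lemma desc_disjoint:
  assumes "w \<in> children v" "w' \<in> children v" "w \<noteq> w'"
  shows "desc w \<inter> desc w' = {}"
  using assms dp_children by (auto simp: desc_def)

lemma parent_notin_desc: "w \<in> children v \<Longrightarrow> v \<notin> desc w"
  using dp_children by (auto simp: desc_def)

lemma arc_parent_desc:
  assumes w: "w \<in> children v" and v: "v \<in> V" and x: "x \<in> desc w"
  shows "(v, x) \<in> A \<longleftrightarrow> x = w"
proof
  assume A: "(v, x) \<in> A"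
  have lt: "dp v < dp x" using x dp_children[OF w] by (auto simp: desc_def)
  with A have "x \<noteq> root" "v = par x" using dp_par by (fastforce simp: arc_iff)+
  then have "dp x = dp w" using A dp_par dp_children[OF w] by (auto simp: arc_iff)
  then show "x = w" using x by (simp add: desc_def)
qed (use w v in \<open>auto simp: arc_iff children_def\<close>)

text \<open>An arc joins a vertex to its parent, and the parent of a vertex in
  \<open>desc w'\<close> is again in \<open>desc w'\<close> or is \<open>v\<close>, which belongs to
  neither subtree.\<close>

lemma arc_desc_desc:
  assumes w: "w \<in> children v" and w': "w' \<in> children v" and ne: "w \<noteq> w'"
    and x: "x \<in> desc w" and y: "y \<in> desc w'"
  shows "(x, y) \<notin> A"
proof
  assume A: "(x, y) \<in> A"
  have *: "\<not> (y \<noteq> root \<and> x = par y)"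
    if w: "w \<in> children v" and w': "w' \<in> children v" and ne: "w \<noteq> w'"
    and x: "x \<in> desc w" and y: "y \<in> desc w'" for w w' x y
  proof
    assume yx: "y \<noteq> root \<and> x = par y"
    show False
    proof (cases "y = w'")
      case True
      then have "x = v" using yx w' by (simp add: children_def)
      with parent_notin_desc[OF w] x show False by simp
    next
      case False
      with par_desc[OF y] yx desc_disjoint[OF w w' ne] x show False by auto
    qed
  qed
  from A *[OF w w' ne x y] *[OF w' w ne[symmetric] y x] show False by (auto simp: arc_iff)
qed

lemma desc_root: "desc root = V"
proof -
  have "(par ^^ dp x) x = root" if "x \<in> V" for x
    using ancestor[OF that, of "dp x"] dp_par by fastforce
  then show ?thesis by (auto simp: desc_def dp_root)
qed

lemma desc_childless: "v \<in> V \<Longrightarrow> children v = {} \<Longrightarrow> desc v = {v}"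
  using desc_eq by simp

lemma neighbors: "v \<in> V \<Longrightarrow> {y. (v, y) \<in> A} = children v \<union> (if v = root then {} else {par v})"
  using par_in by (auto simp: arc_iff children_def)

lemma childless_exists: "\<exists>v\<in>V. children v = {}"
proof -
  obtain v where v: "v \<in> V" "\<And>x. x \<in> V \<Longrightarrow> dp x \<le> dp v"
    using finite_has_max_image[OF finite_V, of dp] root_in by auto
  then have "children v = {}" using dp_children by (fastforce simp: children_def)
  with v show ?thesis by blast
qed

end

lemma is_leaf_iff: "is_leaf T v \<longleftrightarrow> v \<in> pverts T \<and> card {y. (v, y) \<in> parcs T} = 1"
proof -
  have "out_arcs (with_proj T) v = Pair v ` {y. (v, y) \<in> parcs T}"
    by (auto simp: out_arcs_def)
  then show ?thesis
    by (simp add: is_leaf_def out_degree_def card_image inj_on_def)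
qed

lemma (in rooted_tree) childless_is_leaf:
  assumes "pverts T = V" "parcs T = A" "v \<in> V" "v \<noteq> root" "children v = {}"
  shows "is_leaf T v"
  using assms neighbors[of v] by (simp add: is_leaf_iff)

section \<open>Upper bound\<close>

text \<open>Cube corners in the construction, orthants in the lower bound. Extensionality gives
  exactly 2^d of them and lets distinct patterns differ inside \<open>{1..d}\<close>.\<close>

definition sign_patterns :: "nat \<Rightarrow> (nat \<Rightarrow> real) set" where
  "sign_patterns d = {1..d} \<rightarrow>\<^sub>E {- 1, 1}"

lemma finite_sign_patterns: "finite (sign_patterns d)"
  by (auto simp: sign_patterns_def intro: finite_PiE)

lemma card_sign_patterns: "card (sign_patterns d) = 2 ^ d"
  by (simp add: sign_patterns_def card_PiE numeral_2_eq_2)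

text \<open>The excluded patterns are (+,-,...,-), kept for the branches, and in the first bound
  also (-,-,...,-), kept for the parent.\<close>

lemma card_positive_patterns:
  assumes d: "1 \<le> d"
  shows "2 ^ d - 2 \<le> card {\<epsilon> \<in> sign_patterns d. \<exists>i\<in>{2..d}. \<epsilon> i = 1}" (is "_ \<le> card ?K")
  "2 ^ d - 1 \<le> card {\<epsilon> \<in> sign_patterns d. \<epsilon> 1 = - 1 \<or> (\<exists>i\<in>{2..d}. \<epsilon> i = 1)}" (is "_ \<le> card ?K'")
proof -
  define neg :: "real \<Rightarrow> nat \<Rightarrow> real" where
    "neg t = restrict (\<lambda>i. if i = 1 then t else - 1) {1..d}" for t
  have neg: "\<epsilon> = neg (\<epsilon> 1)" if "\<epsilon> \<in> sign_patterns d" "\<not> (\<exists>i\<in>{2..d}. \<epsilon> i = 1)" for \<epsilon>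
  proof
    fix i
    have "\<epsilon> i = - 1" if "i \<in> {2..d}"
      using that \<open>\<epsilon> \<in> _\<close> \<open>\<not> _\<close> unfolding sign_patterns_def PiE_iff by fastforce
    then show "\<epsilon> i = neg (\<epsilon> 1) i"
      using PiE_arb[of \<epsilon> "{1..d}" _ i] \<open>\<epsilon> \<in> _\<close> by (cases "i = 1") (auto simp: neg_def sign_patterns_def)
  qed
  have "\<epsilon> \<in> ?K \<union> {neg 1, neg (- 1)}" if e: "\<epsilon> \<in> sign_patterns d" for \<epsilon>
  proof (cases "\<exists>i\<in>{2..d}. \<epsilon> i = 1")
    case False
    have "\<epsilon> 1 = - 1 \<or> \<epsilon> 1 = 1" using e d by (auto simp: sign_patterns_def PiE_iff)
    then have "\<epsilon> = neg 1 \<or> \<epsilon> = neg (- 1)" using neg[OF e False] by metis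
    then show ?thesis by blast
  qed (use e in blast)
  then have "card (sign_patterns d) \<le> card (?K \<union> {neg 1, neg (- 1)})"
    by (intro card_mono) (auto simp: finite_sign_patterns)
  also have "\<dots> \<le> card ?K + card {neg 1, neg (- 1)}" by (rule card_Un_le)
  also have "card {neg 1, neg (- 1)} \<le> 2" by (simp add: card_insert_if)
  finally show "2 ^ d - 2 \<le> card ?K" by (simp add: card_sign_patterns)
  have "\<epsilon> \<in> ?K' \<union> {neg 1}" if e: "\<epsilon> \<in> sign_patterns d" for \<epsilon>
  proof (cases "\<epsilon> 1 = - 1 \<or> (\<exists>i\<in>{2..d}. \<epsilon> i = 1)")
    case False
    then have F: "\<not> (\<exists>i\<in>{2..d}. \<epsilon> i = 1)" "\<epsilon> 1 \<noteq> - 1" by blast+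
    then have "\<epsilon> 1 = 1" using e d by (auto simp: sign_patterns_def PiE_iff)
    then have "\<epsilon> = neg 1" using neg[OF e F(1)] by metis
    then show ?thesis by blast
  qed (use e in blast)
  then have "card (sign_patterns d) \<le> card (?K' \<union> {neg 1})"
    by (intro card_mono) (auto simp: finite_sign_patterns)
  also have "\<dots> \<le> card ?K' + card {neg 1}" by (rule card_Un_le)
  finally show "2 ^ d - 1 \<le> card ?K'" by (simp add: card_sign_patterns)
qed

lemma sign_patterns_value: "\<epsilon> \<in> sign_patterns d \<Longrightarrow> i \<in> {1..d} \<Longrightarrow> \<epsilon> i = 1 \<or> \<epsilon> i = - 1"
  by (auto simp: sign_patterns_def PiE_iff)

lemma sign_patterns_neq:
  "\<epsilon> \<in> sign_patterns d \<Longrightarrow> \<delta> \<in> sign_patterns d \<Longrightarrow> \<epsilon> \<noteq> \<delta> \<Longrightarrow> \<exists>i\<in>{1..d}. \<epsilon> i \<noteq> \<delta> i"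
  unfolding sign_patterns_def by (metis PiE_ext)

text \<open>Induction on the size of the subtree. Childless vertices are excluded because a single
  point has no other point that attains its radius; they are placed as corners by their
  parent.\<close>

lemma (in rooted_tree) branch_layout_exists:
  assumes T: "pverts T = V" "parcs T = A" and d: "2 \<le> d"
    and leaves: "\<And>x. x \<in> V \<Longrightarrow> x \<noteq> root \<Longrightarrow> card (leaf_neighbors T x) \<le> 2 ^ d - 2"
    and leaves_root: "card (leaf_neighbors T root) \<le> 2 ^ d - 1"
    and v: "v \<in> V" and ne: "children v \<noteq> {}"
  shows "\<exists>f r. branch_layout d A v f r (desc v) \<and> (v \<noteq> root \<longrightarrow> escaping d v f r (desc v))"
  using v ne
proof (induction "card (desc v)" arbitrary: v rule: less_induct)
  case less
  define L where "L = {w \<in> children v. children w = {}}"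
  define N where "N = {w \<in> children v. children w \<noteq> {}}"
  have fin: "finite (children v)" using finite_V by (simp add: children_def)
  have chV: "children w \<subseteq> V" for w by (auto simp: children_def)
  have "\<exists>f r. branch_layout d A w f r (desc w) \<and> escaping d w f r (desc w)" if w: "w \<in> N" for w
  proof -
    have wc: "w \<in> children v" and ww: "children w \<noteq> {}" using w by (auto simp: N_def)
    have "desc w \<subset> desc v"
      using desc_eq[OF less.prems(1)] wc parent_notin_desc[OF wc] by blast
    moreover have "finite (desc v)" using finite_V by (simp add: desc_def)
    ultimately have "card (desc w) < card (desc v)" by (rule psubset_card_mono[rotated])
    then show ?thesis using less.hyps[of w] wc ww by (auto simp: children_def)
  qed
  then obtain F R where FR: "\<And>w. w \<in> N \<Longrightarrow> branch_layout d A w (F w) (R w) (desc w) \<and> escaping d w (F w) (R w) (desc w)"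
    by metis
  define K where "K = (if v = root then {\<epsilon> \<in> sign_patterns d. \<epsilon> 1 = - 1 \<or> (\<exists>i\<in>{2..d}. \<epsilon> i = 1)}
      else {\<epsilon> \<in> sign_patterns d. \<exists>i\<in>{2..d}. \<epsilon> i = 1})"
  \<comment> \<open>Only an inclusion, since the parent of \<open>v\<close> may be a leaf
    too.\<close>
  have "L \<subseteq> leaf_neighbors T v"
    using childless_is_leaf[OF T] less.prems(1) by (auto simp: L_def leaf_neighbors_def children_def T arc_iff)
  moreover have "finite (leaf_neighbors T v)"
    by (rule finite_subset[OF _ finite_V]) (auto simp: leaf_neighbors_def T arc_iff)
  ultimately have "card L \<le> card (leaf_neighbors T v)" by (rule card_mono[rotated])
  also have "\<dots> \<le> card K"
    using leaves[OF less.prems(1)] leaves_root card_positive_patterns[of d] d by (auto simp: K_def)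
  finally have "card L \<le> card K" .
  moreover have "finite L" "finite K" using fin by (auto simp: L_def K_def finite_sign_patterns)
  ultimately obtain \<epsilon> where eps: "\<epsilon> ` L \<subseteq> K" "inj_on \<epsilon> L"
    using card_le_inj[of L K] by metis
  have eps_s: "\<epsilon> l \<in> sign_patterns d" if "l \<in> L" for l
    using eps(1) that by (auto simp: K_def split: if_splits)
  have dL: "desc l = {l}" if "l \<in> L" for l
    using desc_childless[of l] that chV by (auto simp: L_def)
  have LN: "l \<in> children v" "w \<in> children v" "l \<noteq> w" if "l \<in> L" "w \<in> N" for l w
    using that by (auto simp: L_def N_def)
  have U: "desc v = {v} \<union> L \<union> (\<Union>w\<in>N. desc w)"
    unfolding desc_eq[OF less.prems(1)] using dL by (fastforce simp: L_def N_def)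
  have "\<exists>f r. branch_layout d A v f r ({v} \<union> L \<union> (\<Union>w\<in>N. desc w)) \<and>
    ((\<forall>l\<in>L. \<exists>i\<in>{2..d}. \<epsilon> l i = 1) \<longrightarrow> escaping d v f r ({v} \<union> L \<union> (\<Union>w\<in>N. desc w)))"
  proof (rule branch_compose[OF d sym_A _ _ FR])
    show "finite N" using fin by (simp add: N_def)
    show "L \<union> N \<noteq> {}" using less.prems(2) by (auto simp: L_def N_def)
    show "v \<notin> L"
      using less.prems(2) by (auto simp: L_def)
    show "v \<notin> desc w" if "w \<in> N" for w using that parent_notin_desc by (auto simp: N_def)
    show "L \<inter> desc w = {}" if "w \<in> N" for w
      using desc_disjoint[of _ v w] LN[OF _ that] dL by fastforce
    show "desc w \<inter> desc w' = {}" if "w \<in> N" "w' \<in> N" "w \<noteq> w'" for w w'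
      using desc_disjoint[of w v w'] that by (auto simp: N_def)
    show "(v, l) \<in> A" if "l \<in> L" for l
      using that less.prems(1) by (auto simp: L_def children_def arc_iff)
    show "(l, l') \<notin> A" if "l \<in> L" "l' \<in> L" for l l'
      using arc_desc_desc[of l v l' l l'] that dL no_loop by (cases "l = l'") (auto simp: L_def)
    show "(v, x) \<in> A \<longleftrightarrow> x = w" if "w \<in> N" "x \<in> desc w" for w x
      using arc_parent_desc[of w v x] that less.prems(1) by (auto simp: N_def)
    show "(l, x) \<notin> A" if "w \<in> N" "x \<in> desc w" "l \<in> L" for w l x
      using arc_desc_desc[of l v w l x] LN[OF that(3,1)] that dL by auto
    show "(x, y) \<notin> A" if "w \<in> N" "w' \<in> N" "w \<noteq> w'" "x \<in> desc w" "y \<in> desc w'" for w w' x y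
      using arc_desc_desc[of w v w' x y] that by (auto simp: N_def)
    show "\<epsilon> l i = 1 \<or> \<epsilon> l i = - 1" if "l \<in> L" "i \<in> {1..d}" for l i
      using sign_patterns_value[OF eps_s] that by blast
    show "\<exists>i\<in>{1..d}. \<epsilon> l i \<noteq> \<epsilon> l' i" if "l \<in> L" "l' \<in> L" "l \<noteq> l'" for l l'
      using sign_patterns_neq[OF eps_s[OF that(1)] eps_s[OF that(2)]] that eps(2) by (meson inj_onD)
    show "\<epsilon> l 1 = - 1 \<or> (\<exists>i\<in>{2..d}. \<epsilon> l i = 1)" if "l \<in> L" for l
      using that eps(1) by (auto simp: K_def split: if_splits)
  qed
  moreover have "\<forall>l\<in>L. \<exists>i\<in>{2..d}. \<epsilon> l i = 1" if "v \<noteq> root"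
    using eps(1) that by (auto simp: K_def)
  ultimately show ?case unfolding U by blast
qed

section \<open>Leaf-degrees and the choice of the root\<close>

lemma finite_leaf_neighbors: "pair_graph T \<Longrightarrow> finite (leaf_neighbors T x)"
proof -
  assume "pair_graph T"
  then interpret pair_graph T .
  show ?thesis
    by (rule finite_subset[OF _ pair_finite_verts]) (auto simp: leaf_neighbors_def is_leaf_def)
qed

lemma card_leaf_neighbors_le:
  "finite (pverts T) \<Longrightarrow> x \<in> pverts T \<Longrightarrow> card (leaf_neighbors T x) \<le> leaf_alpha T"
  by (simp add: leaf_alpha_def)

lemma max_leaf_vertices_nonempty:
  assumes "finite (pverts T)" "pverts T \<noteq> {}" shows "max_leaf_vertices T \<noteq> {}"
proof -
  have "leaf_alpha T \<in> (\<lambda>x. card (leaf_neighbors T x)) ` pverts T"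
    unfolding leaf_alpha_def using assms by (intro Max_in) auto
  then show ?thesis by (auto simp: max_leaf_vertices_def)
qed

text \<open>With one maximal vertex set aside as the root, either another one attains
  \<open>leaf_alpha\<close>, which then equals \<open>leaf_beta\<close>, or all others fall short of
  it by at least one.\<close>

lemma leaf_beta_max:
  assumes fin: "finite (pverts T)" and v: "v \<in> max_leaf_vertices T"
    and x: "x \<in> pverts T" "x \<noteq> v"
  shows "card (leaf_neighbors T x) \<le> leaf_beta T"
proof -
  have le: "card (leaf_neighbors T x) \<le> leaf_alpha T"
    by (rule card_leaf_neighbors_le[OF fin x(1)])
  show ?thesis
  proof (cases "2 \<le> card (max_leaf_vertices T)")
    case True
    with le show ?thesis by (simp add: leaf_beta_def)
  next
    case False
    have "x \<notin> max_leaf_vertices T"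
    proof
      assume "x \<in> max_leaf_vertices T"
      then have "card {x, v} \<le> card (max_leaf_vertices T)"
        using v fin by (intro card_mono) (auto simp: max_leaf_vertices_def)
      with False x(2) show False by simp
    qed
    with le x(1) have "card (leaf_neighbors T x) < leaf_alpha T" by (auto simp: max_leaf_vertices_def)
    with False show ?thesis by (simp add: leaf_beta_def)
  qed
qed

text \<open>Root the tree at \<open>r\<close>: any childless vertex is a leaf other than
  \<open>r\<close>.\<close>

lemma leaf_exists_avoiding:
  assumes T: "undirected_tree T" and card: "2 \<le> card (pverts T)" and r: "r \<in> pverts T"
  shows "\<exists>y. is_leaf T y \<and> y \<noteq> r"
proof -
  obtain par dp where "rooted_tree (pverts T) (parcs T) r par dp"
    using undirected_tree_rooted[OF T r] by blast
  then interpret rooted_tree "pverts T" "parcs T" r par dp .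
  obtain y where y: "y \<in> pverts T" "children y = {}" using childless_exists by blast
  have "y \<noteq> r"
  proof
    assume "y = r"
    then have "pverts T = {r}" using desc_childless[OF y] desc_root by simp
    with card show False by simp
  qed
  with y childless_is_leaf[OF refl refl y(1)] show ?thesis by blast
qed

lemma leaf_has_neighbor:
  assumes T: "pair_graph T" and y: "is_leaf T y"
  shows "\<exists>x\<in>pverts T. y \<in> leaf_neighbors T x"
proof -
  interpret pair_graph T by (rule T)
  have "{x. (y, x) \<in> parcs T} \<noteq> {}" using y unfolding is_leaf_iff by (metis card.empty zero_neq_one)
  then obtain x where "(y, x) \<in> parcs T" by blast
  then have "x \<in> pverts T" "y \<in> leaf_neighbors T x"
    using arcs_symmetric in_arcsD2 y by (auto simp: leaf_neighbors_def)
  then show ?thesis by blast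
qed

text \<open>If \<beta> were 0, all leaves would hang on one vertex; there are at least two of them,
  so \<alpha> would be at least 2 and \<beta> at least 1. The bound guarantees the two coordinates
  that \<open>branch_compose\<close> works with.\<close>

lemma leaf_beta_pos:
  assumes T: "undirected_tree T" and card: "2 \<le> card (pverts T)"
  shows "1 \<le> leaf_beta T"
proof (rule ccontr)
  interpret pair_graph T using T by (simp add: undirected_tree_def)
  note fin = finite_leaf_neighbors[OF pair_graph]
  assume "\<not> 1 \<le> leaf_beta T"
  then have \<beta>: "leaf_beta T = 0" by simp
  have ne: "pverts T \<noteq> {}" using card by auto
  obtain v where v: "v \<in> max_leaf_vertices T"
    using max_leaf_vertices_nonempty[OF pair_finite_verts ne] by blast
  have only: "x = v" if "x \<in> pverts T" "y \<in> leaf_neighbors T x" for x y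
    using leaf_beta_max[OF pair_finite_verts v that(1)] \<beta> fin that(2) by fastforce
  obtain y where y: "is_leaf T y" using leaf_exists_avoiding[OF T card] ne by blast
  then obtain y' where y': "is_leaf T y'" "y' \<noteq> y"
    using leaf_exists_avoiding[OF T card, of y] by (auto simp: is_leaf_iff)
  have "{y, y'} \<subseteq> leaf_neighbors T v"
    using leaf_has_neighbor[OF pair_graph] only y y' by blast
  then have "card {y, y'} \<le> card (leaf_neighbors T v)" by (rule card_mono[OF fin])
  then have "2 \<le> leaf_alpha T" using y' v by (simp add: max_leaf_vertices_def)
  then show False using \<beta> by (simp add: leaf_beta_def split: if_splits)
qed

text \<open>The root has at most \<beta> + 1 leaf neighbours and every other vertex at most \<beta>;
  both budgets amount to \<beta> + 2 \<le> 2^d.\<close>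

lemma layout_exists:
  assumes T: "undirected_tree T" and card: "2 \<le> card (pverts T)"
    and d: "leaf_beta T + 2 \<le> 2 ^ d"
  shows "\<exists>f r. sig_layout d (parcs T) f r (pverts T)"
proof -
  interpret pair_graph T using T by (simp add: undirected_tree_def)
  have d2: "2 \<le> d"
  proof (rule ccontr)
    assume "\<not> 2 \<le> d"
    then have "d = 0 \<or> d = 1" by auto
    with d leaf_beta_pos[OF T card] show False by auto
  qed
  have ne: "pverts T \<noteq> {}" using card by auto
  obtain v where v: "v \<in> max_leaf_vertices T"
    using max_leaf_vertices_nonempty[OF pair_finite_verts ne] by blast
  then have vV: "v \<in> pverts T" by (simp add: max_leaf_vertices_def)
  obtain par dp where "rooted_tree (pverts T) (parcs T) v par dp"
    using undirected_tree_rooted[OF T vV] by blast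
  then interpret rt: rooted_tree "pverts T" "parcs T" v par dp .
  have "card (leaf_neighbors T v) \<le> leaf_beta T + 1"
    using v by (auto simp: max_leaf_vertices_def leaf_beta_def)
  then have 1: "card (leaf_neighbors T v) \<le> 2 ^ d - 1" using d by simp
  have 2: "card (leaf_neighbors T x) \<le> 2 ^ d - 2" if "x \<in> pverts T" "x \<noteq> v" for x
    using leaf_beta_max[OF pair_finite_verts v that] d by simp
  have 3: "rt.children v \<noteq> {}"
    using rt.desc_childless[OF vV] rt.desc_root card by auto
  show ?thesis
    using rt.branch_layout_exists[OF refl refl d2 2 1 vV 3] rt.desc_root
    by (auto simp: branch_layout_def)
qed

section \<open>Lower bound\<close>

locale tree_layout = pair_graph T for T :: "'a pair_pre_digraph" +
  fixes d :: nat and f :: "'a \<Rightarrow> nat \<Rightarrow> real" and r :: "'a \<Rightarrow> real"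
  assumes layout: "sig_layout d (parcs T) f r (pverts T)"
begin

lemma radius_pos: "x \<in> pverts T \<Longrightarrow> 0 < r x"
  using layout by (simp add: sig_layout_def)

lemma near:
  assumes "(x, y) \<in> parcs T" "i \<in> {1..d}" shows "\<bar>f x i - f y i\<bar> < r x + r y"
  using layout assms in_arcsD1 in_arcsD2 no_loops' unfolding sig_layout_def edge_compatible_def by metis

lemma near_attained:
  assumes "(x, y) \<in> parcs T" shows "\<exists>i\<in>{1..d}. r x \<le> \<bar>f x i - f y i\<bar>"
  using layout assms in_arcsD1 in_arcsD2 no_loops' unfolding sig_layout_def edge_compatible_def by metis

lemma far:
  assumes "(x, y) \<notin> parcs T" "x \<in> pverts T" "y \<in> pverts T" "x \<noteq> y"
  shows "\<exists>i\<in>{1..d}. r x + r y \<le> \<bar>f x i - f y i\<bar>"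
  using layout assms unfolding sig_layout_def edge_compatible_def by metis

lemma leaf_neighbor_unique:
  assumes "p \<in> leaf_neighbors T v" "(p, y) \<in> parcs T" shows "y = v"
proof -
  have "card {y. (p, y) \<in> parcs T} = 1" "(p, v) \<in> parcs T"
    using assms arcs_symmetric by (auto simp: leaf_neighbors_def is_leaf_iff)
  then show ?thesis using assms(2) by (metis card_1_singletonE mem_Collect_eq singletonD)
qed

text \<open>A non-neighbour \<open>y\<close> of \<open>p\<close> is at distance at least
  \<open>r p + r y\<close>, which exceeds \<open>r p\<close>; so the point attaining
  \<open>r p\<close> is a neighbour of \<open>p\<close>, that is, \<open>v\<close>.\<close>

lemma leaf_radius:
  assumes p: "p \<in> leaf_neighbors T v"
  shows "\<forall>i\<in>{1..d}. \<bar>f p i - f v i\<bar> \<le> r p" "r v \<le> r p"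
proof -
  have pv: "(v, p) \<in> parcs T" and pV: "p \<in> pverts T"
    using p in_arcsD2 by (auto simp: leaf_neighbors_def)
  obtain y where y: "y \<in> pverts T" "y \<noteq> p" "\<forall>i\<in>{1..d}. \<bar>f p i - f y i\<bar> \<le> r p"
    using layout pV unfolding sig_layout_def by metis
  have "(p, y) \<in> parcs T"
  proof (rule ccontr)
    assume "(p, y) \<notin> parcs T"
    then obtain i where "i \<in> {1..d}" "r p + r y \<le> \<bar>f p i - f y i\<bar>" using far pV y by metis
    with y radius_pos[OF y(1)] show False by fastforce
  qed
  then have "y = v" using leaf_neighbor_unique[OF p] by blast
  with y show *: "\<forall>i\<in>{1..d}. \<bar>f p i - f v i\<bar> \<le> r p" by simp
  obtain i where "i \<in> {1..d}" "r v \<le> \<bar>f v i - f p i\<bar>" using near_attained[OF pv] by blast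
  with * show "r v \<le> r p" by (force simp: abs_minus_commute)
qed

text \<open>Ties count as -1, which is harmless: opposite sides are always established by strict
  inequalities.\<close>

definition orthant :: "'a \<Rightarrow> 'a \<Rightarrow> nat \<Rightarrow> real" where
  "orthant v x = restrict (\<lambda>i. if f v i < f x i then 1 else - 1) {1..d}"

lemma orthant_in: "orthant v x \<in> sign_patterns d"
  by (auto simp: orthant_def sign_patterns_def)

text \<open>Take a coordinate that separates the balls of \<open>p\<close> and \<open>u\<close>. If
  both points were on the same side of \<open>v\<close> there, their difference would be at most the
  larger of their differences from \<open>v\<close>, which are at most \<open>r p\<close> and less
  than \<open>r v + r u \<le> r p + r u\<close>.\<close>

lemma orthant_opposite:
  assumes p: "p \<in> leaf_neighbors T v" and u: "(v, u) \<in> parcs T" "u \<noteq> p"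
  shows "\<exists>i\<in>{1..d}. r p + r u \<le> \<bar>f p i - f u i\<bar> \<and> orthant v p i \<noteq> orthant v u i"
proof -
  have V: "p \<in> pverts T" "u \<in> pverts T" "u \<noteq> v"
    using p u in_arcsD2 no_loops' by (auto simp: leaf_neighbors_def)
  have "(p, u) \<notin> parcs T" using leaf_neighbor_unique[OF p] V by blast
  then obtain i where i: "i \<in> {1..d}" "r p + r u \<le> \<bar>f p i - f u i\<bar>" using far V u by metis
  moreover have "\<bar>f p i - f v i\<bar> \<le> r p" "r v \<le> r p" using leaf_radius[OF p] i by auto
  moreover have "\<bar>f v i - f u i\<bar> < r v + r u" using near[OF u(1) i(1)] .
  ultimately have "f v i < f p i \<and> f u i < f v i \<or> f p i < f v i \<and> f v i < f u i"
    using radius_pos V by (smt (verit))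
  with i show ?thesis by (intro bexI[of _ i]) (auto simp: orthant_def)
qed

text \<open>Of two distinct members at least one is a leaf at \<open>v\<close>, as
  \<open>orthant_opposite\<close> demands. Since \<open>u\<close> may itself be a leaf, one
  statement serves both counts of orthants.\<close>

lemma orthant_inj:
  assumes u: "(v, u) \<in> parcs T"
  shows "inj_on (orthant v) (insert u (leaf_neighbors T v))"
proof (rule inj_onI, rule ccontr)
  fix x y
  assume xy: "x \<in> insert u (leaf_neighbors T v)" "y \<in> insert u (leaf_neighbors T v)"
    "orthant v x = orthant v y" "x \<noteq> y"
  then have "(v, x) \<in> parcs T" "(v, y) \<in> parcs T" using u by (auto simp: leaf_neighbors_def)
  moreover have "x \<in> leaf_neighbors T v \<or> y \<in> leaf_neighbors T v" using xy by auto
  ultimately show False using orthant_opposite[of x v y] orthant_opposite[of y v x] xy(3,4) by auto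
qed

lemma card_leaf_neighbors_insert:
  assumes u: "(v, u) \<in> parcs T"
  shows "card (insert u (leaf_neighbors T v)) \<le> 2 ^ d"
  unfolding card_sign_patterns[symmetric]
  by (rule card_inj_on_le[OF orthant_inj[OF u]]) (auto simp: orthant_in finite_sign_patterns)

text \<open>
  All orthants at \<^term>\<open>v\<close> are occupied, so some leaf occupies the one that differs from that of
  \<^term>\<open>u\<close> in coordinate \<^term>\<open>i\<close> only; the two balls can be separated only there.
\<close>

lemma saturated_far:
  assumes sat: "card (leaf_neighbors T v) + 1 = 2 ^ d"
    and u: "(v, u) \<in> parcs T" "u \<notin> leaf_neighbors T v" and i: "i \<in> {1..d}"
  shows "r u \<le> \<bar>f u i - f v i\<bar>"
proof -
  let ?X = "insert u (leaf_neighbors T v)"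
  have fin: "finite (leaf_neighbors T v)" by (rule finite_leaf_neighbors) (rule pair_graph)
  have "orthant v ` ?X = sign_patterns d"
  proof (rule card_subset_eq[OF finite_sign_patterns])
    show "card (orthant v ` ?X) = card (sign_patterns d)"
      using sat u(2) fin by (simp add: card_image[OF orthant_inj[OF u(1)]] card_sign_patterns del: image_insert)
  qed (auto simp: orthant_in)
  moreover have "(orthant v u)(i := - orthant v u i) \<in> sign_patterns d"
    using orthant_in[of v u] i unfolding sign_patterns_def by (auto simp: PiE_iff extensional_def)
  ultimately obtain p where p: "p \<in> ?X" "orthant v p = (orthant v u)(i := - orthant v u i)"
    by (metis (no_types, lifting) imageE)
  have "orthant v u i \<noteq> 0" using i by (simp add: orthant_def)
  then have "p \<noteq> u" using p(2) by (metis fun_upd_same equal_neg_zero)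
  then have pL: "p \<in> leaf_neighbors T v" using p by simp
  obtain j where j: "j \<in> {1..d}" "r p + r u \<le> \<bar>f p j - f u j\<bar>" "orthant v p j \<noteq> orthant v u j"
    using orthant_opposite[OF pL u(1)] \<open>p \<noteq> u\<close> by blast
  have "j = i" using j(3) p(2) by (metis fun_upd_other)
  then have "r p + r u \<le> \<bar>f p i - f u i\<bar>" using j(2) by simp
  moreover have "\<bar>f p i - f v i\<bar> \<le> r p" using leaf_radius[OF pL] i by blast
  ultimately show ?thesis by linarith
qed

text \<open>\<open>saturated_far\<close> is applied at each \<open>x\<close> with \<open>w\<close>
  as the additional, non-leaf neighbour. In a common orthant at \<open>w\<close>, the offsets of
  \<open>x\<close> and \<open>y\<close> from \<open>w\<close> have equal signs and sizes in
  [\<open>r w\<close>, \<open>r w + r x\<close>) and [\<open>r w\<close>, \<open>r w + r y\<close>),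
  so they differ by less than \<open>r x + r y\<close> in every coordinate.\<close>

lemma saturated_neighbors_bound:
  assumes X: "\<And>x. x \<in> X \<Longrightarrow> (w, x) \<in> parcs T \<and> card (leaf_neighbors T x) + 1 = 2 ^ d"
    and w: "\<not> is_leaf T w" and indep: "\<And>x y. x \<in> X \<Longrightarrow> y \<in> X \<Longrightarrow> (x, y) \<notin> parcs T"
  shows "card X \<le> 2 ^ d"
proof -
  have "inj_on (orthant w) X"
  proof (rule inj_onI, rule ccontr)
    fix x y assume xy: "x \<in> X" "y \<in> X" "orthant w x = orthant w y" "x \<noteq> y"
    have V: "w \<in> pverts T" "x \<in> pverts T" "y \<in> pverts T" using X xy in_arcsD1 in_arcsD2 by blast+
    have *: "r w \<le> \<bar>f w i - f z i\<bar>" "\<bar>f w i - f z i\<bar> < r w + r z" if "z \<in> X" "i \<in> {1..d}" for z i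
    proof -
      have "(z, w) \<in> parcs T" using X that arcs_symmetric by blast
      then show "r w \<le> \<bar>f w i - f z i\<bar>"
        using saturated_far[of z w i] X that w by (auto simp: leaf_neighbors_def)
      show "\<bar>f w i - f z i\<bar> < r w + r z" using near X that by blast
    qed
    obtain i where i: "i \<in> {1..d}" "r x + r y \<le> \<bar>f x i - f y i\<bar>"
      using far[OF indep[OF xy(1,2)] V(2,3) xy(4)] by blast
    have "orthant w x i = orthant w y i" using xy(3) by simp
    then have "f w i < f x i \<longleftrightarrow> f w i < f y i" using i(1) by (auto simp: orthant_def split: if_splits)
    then show False
      using *[OF xy(1) i(1)] *[OF xy(2) i(1)] i(2) radius_pos[OF V(1)] radius_pos[OF V(2)] radius_pos[OF V(3)]
      by (smt (verit))
  qed
  then have "card X \<le> card (sign_patterns d)"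
    by (rule card_inj_on_le) (auto simp: orthant_in finite_sign_patterns)
  then show ?thesis by (simp add: card_sign_patterns)
qed

end

text \<open>Settles the case of the lower bound in which a maximal vertex has no non-leaf neighbour:
  the tree is then a star around \<open>v\<close>, and any other vertex is a leaf.\<close>

lemma leaf_neighbors_of_star_center:
  assumes T: "undirected_tree T" and v: "v \<in> pverts T" and w: "w \<in> pverts T" "w \<noteq> v"
    and star: "\<And>u. (v, u) \<in> parcs T \<Longrightarrow> is_leaf T u"
  shows "card (leaf_neighbors T w) \<le> 1"
proof -
  obtain par dp where "rooted_tree (pverts T) (parcs T) v par dp"
    using undirected_tree_rooted[OF T v] by blast
  then interpret rooted_tree "pverts T" "parcs T" v par dp .
  have "w \<in> desc v" using desc_root w by simp
  then obtain c where c: "c \<in> children v" "w \<in> desc c" using desc_eq[OF v] w by auto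
  then have cV: "c \<in> pverts T" "c \<noteq> v" "par c = v" by (auto simp: children_def)
  have "(v, c) \<in> parcs T" using cV v by (auto simp: arc_iff)
  then have "is_leaf T c" by (rule star)
  then have "card {y. (c, y) \<in> parcs T} = 1" by (simp only: is_leaf_iff)
  moreover have "{y. (c, y) \<in> parcs T} = children c \<union> {v}"
    unfolding neighbors[OF cV(1)] using cV(2,3) by simp
  ultimately have "card (children c \<union> {v}) = 1" by (simp only:)
  moreover have "v \<notin> children c" by (simp add: children_def)
  ultimately have "children c = {}" by (auto simp: card_1_singleton_iff)
  then have "w = c" using c desc_childless[OF cV(1)] by auto
  have fin: "finite {y. (w, y) \<in> parcs T}"
    by (rule finite_subset[OF _ finite_V]) (auto simp: arc_iff)
  have "card (leaf_neighbors T w) \<le> card {y. (w, y) \<in> parcs T}"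
    by (rule card_mono[OF fin]) (auto simp: leaf_neighbors_def)
  also have "\<dots> = 1" using \<open>is_leaf T c\<close> \<open>w = c\<close> by (simp only: is_leaf_iff)
  finally show ?thesis .
qed

text \<open>With two maximal vertices, a non-leaf neighbour of \<open>v\<close> takes one more
  orthant than the leaves; if there is none, \<open>leaf_alpha\<close> is at most 1. With one
  maximal vertex the leaves at \<open>v\<close> alone fill at most 2^d orthants, and \<beta> is
  smaller by one.\<close>

lemma leaf_beta_bound:
  assumes T: "undirected_tree T" and card: "2 \<le> card (pverts T)" and d: "1 \<le> d"
    and lay: "sig_layout d (parcs T) f r (pverts T)"
  shows "leaf_beta T + 1 \<le> 2 ^ d"
proof -
  interpret pair_graph T using T by (simp add: undirected_tree_def)
  interpret tree_layout T d f r by unfold_locales (rule lay)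
  have fin: "finite (leaf_neighbors T v)" for v by (rule finite_leaf_neighbors) (rule pair_graph)
  have ne: "pverts T \<noteq> {}" using card by auto
  obtain v where v: "v \<in> max_leaf_vertices T"
    using max_leaf_vertices_nonempty[OF pair_finite_verts ne] by blast
  then have vV: "v \<in> pverts T" and \<alpha>: "card (leaf_neighbors T v) = leaf_alpha T"
    by (simp_all add: max_leaf_vertices_def)
  have d2: "(2::nat) \<le> 2 ^ d" using power_increasing[OF d, of "2::nat"] by simp
  show ?thesis
  proof (cases "2 \<le> card (max_leaf_vertices T)")
    case True
    have "leaf_alpha T + 1 \<le> 2 ^ d"
    proof (cases "\<exists>u. (v, u) \<in> parcs T \<and> \<not> is_leaf T u")
      case True
      then obtain u where u: "(v, u) \<in> parcs T" "u \<notin> leaf_neighbors T v" by (auto simp: leaf_neighbors_def)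
      show ?thesis using card_leaf_neighbors_insert[OF u(1)] u(2) fin \<alpha> by simp
    next
      case False
      have "\<not> max_leaf_vertices T \<subseteq> {v}"
      proof
        assume "max_leaf_vertices T \<subseteq> {v}"
        then have "card (max_leaf_vertices T) \<le> card {v}" by (intro card_mono) auto
        with True show False by simp
      qed
      then obtain w where "w \<in> max_leaf_vertices T" "w \<noteq> v" by blast
      then have "leaf_alpha T \<le> 1"
        using leaf_neighbors_of_star_center[OF T vV, of w] False by (auto simp: max_leaf_vertices_def)
      with d2 show ?thesis by simp
    qed
    with True show ?thesis by (simp add: leaf_beta_def)
  next
    case False
    have "leaf_alpha T \<le> 2 ^ d"
    proof (cases "leaf_neighbors T v = {}")
      case True with \<alpha> show ?thesis by simp
    next
      case False
      then obtain u where u: "u \<in> leaf_neighbors T v" by blast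
      then have "insert u (leaf_neighbors T v) = leaf_neighbors T v" by blast
      with u card_leaf_neighbors_insert[of v u] \<alpha> show ?thesis by (simp add: leaf_neighbors_def)
    qed
    with False d2 show ?thesis by (simp add: leaf_beta_def)
  qed
qed

section \<open>The dimension and extremal trees\<close>

lemma SIG_inf_le:
  assumes T: "pair_graph T" and "1 \<le> d" and "2 \<le> card (pverts T)"
    and "sig_layout d (parcs T) f r (pverts T)"
  shows "SIG_inf T \<le> d"
  unfolding SIG_inf_def using sig_representation_iff_layout[OF assms(1-3)] assms(2,4)
  by (intro Least_le) blast

lemma SIG_inf_layout:
  assumes T: "undirected_tree T" and card: "2 \<le> card (pverts T)"
  shows "1 \<le> SIG_inf T" "\<exists>f r. sig_layout (SIG_inf T) (parcs T) f r (pverts T)"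
proof -
  have g: "pair_graph T" using T by (simp add: undirected_tree_def)
  \<comment> \<open>Some dimension must be known to work before \<open>LEAST\<close> can be
    evaluated; n < 2^n supplies one.\<close>
  let ?d = "leaf_beta T + 2"
  have "leaf_beta T + 2 \<le> 2 ^ ?d" by (rule less_imp_le) (rule less_exp)
  then have "\<exists>P. is_sig_representation ?d P T"
    using layout_exists[OF T card] sig_representation_iff_layout[OF g _ card] by simp
  then have "1 \<le> SIG_inf T \<and> (\<exists>P. is_sig_representation (SIG_inf T) P T)"
    unfolding SIG_inf_def by (intro LeastI[of "\<lambda>d. 1 \<le> d \<and> (\<exists>P. is_sig_representation d P T)" ?d]) simp
  then show "1 \<le> SIG_inf T" "\<exists>f r. sig_layout (SIG_inf T) (parcs T) f r (pverts T)"
    using sig_representation_iff_layout[OF g _ card] by auto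
qed

lemma SIG_inf_lower:
  assumes T: "undirected_tree T" and card: "2 \<le> card (pverts T)"
  shows "leaf_beta T + 1 \<le> 2 ^ SIG_inf T"
  using SIG_inf_layout[OF assms] leaf_beta_bound[OF assms] by blast

lemma SIG_inf_upper:
  assumes T: "undirected_tree T" and card: "2 \<le> card (pverts T)" and d: "leaf_beta T + 2 \<le> 2 ^ d"
  shows "SIG_inf T \<le> d"
proof -
  have g: "pair_graph T" using T by (simp add: undirected_tree_def)
  have "1 \<le> d" using d by (cases d) auto
  then show ?thesis using layout_exists[OF assms] SIG_inf_le[OF g _ card] by blast
qed

lemma SIG_inf_eq_log:
  assumes T: "undirected_tree T" and card: "2 \<le> card (pverts T)"
    and no: "\<nexists>k::nat. 1 \<le> k \<and> leaf_beta T = 2 ^ k - 1"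
  shows "int (SIG_inf T) = \<lceil>log 2 (real (leaf_beta T) + 2)\<rceil>"
proof -
  let ?b = "leaf_beta T" and ?s = "SIG_inf T"
  have s1: "1 \<le> ?s" by (rule SIG_inf_layout(1)[OF T card])
  \<comment> \<open>The excluded values are exactly those with equality in the lower bound, which
    therefore improves by one.\<close>
  have "?b \<noteq> 2 ^ ?s - 1" using no s1 by blast
  with SIG_inf_lower[OF T card] have up: "?b + 2 \<le> 2 ^ ?s" by simp
  \<comment> \<open>Otherwise the construction would already work one dimension lower.\<close>
  have "\<not> ?b + 2 \<le> 2 ^ (?s - 1)"
  proof
    assume "?b + 2 \<le> 2 ^ (?s - 1)"
    from SIG_inf_upper[OF T card this] s1 show False by simp
  qed
  then have lo: "2 ^ (?s - 1) < ?b + 2" by simp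
  have "real (?b + 2) \<le> 2 ^ ?s" using up by (metis of_nat_le_iff of_nat_numeral of_nat_power)
  moreover have "2 ^ (?s - 1) < real (?b + 2)" using lo by (metis of_nat_less_iff of_nat_numeral of_nat_power)
  ultimately have "log 2 (real ?b + 2) \<le> real ?s" "real (?s - 1) < log 2 (real ?b + 2)"
    by (simp_all add: log_le_iff less_log_iff powr_realpow)
  then show ?thesis using s1 by (intro ceiling_unique[symmetric]) (simp_all add: of_nat_diff)
qed

lemma SIG_inf_power:
  assumes T: "undirected_tree T" and card: "2 \<le> card (pverts T)"
    and k: "1 \<le> k" "leaf_beta T = 2 ^ k - 1"
  shows "SIG_inf T \<in> {k, k + 1}"
proof -
  have "(2::nat) ^ 1 \<le> 2 ^ k" using k by (intro power_increasing) auto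
  then have b: "leaf_beta T + 1 = 2 ^ k" "leaf_beta T + 2 \<le> 2 ^ (k + 1)" using k(2) by simp_all
  have "(2::nat) ^ k \<le> 2 ^ SIG_inf T" using SIG_inf_lower[OF T card] b by simp
  then have "k \<le> SIG_inf T" by (simp add: power_increasing_iff)
  moreover have "SIG_inf T \<le> k + 1" by (rule SIG_inf_upper[OF T card b(2)])
  ultimately show ?thesis by auto
qed

section \<open>Trees given by parent functions\<close>

definition parent_graph :: "nat \<Rightarrow> (nat \<Rightarrow> nat) \<Rightarrow> nat pair_pre_digraph" where
  "parent_graph n par = \<lparr>pverts = {..n}, parcs = {(x, y). x \<le> n \<and> y \<le> n \<and>
     (x \<noteq> 0 \<and> y = par x \<or> y \<noteq> 0 \<and> x = par y)}\<rparr>"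

lemma parent_graph_rooted_tree:
  assumes "dp 0 = 0" "\<And>x. 0 < x \<Longrightarrow> x \<le> n \<Longrightarrow> par x \<le> n \<and> dp x = Suc (dp (par x))"
  shows "rooted_tree (pverts (parent_graph n par)) (parcs (parent_graph n par)) 0 par dp"
proof
  show "dp x = Suc (dp (par x))" if "x \<in> pverts (parent_graph n par)" "x \<noteq> 0" for x
    using assms(2)[of x] that unfolding parent_graph_def by simp
  show "par x \<in> pverts (parent_graph n par)" if "x \<in> pverts (parent_graph n par)" "x \<noteq> 0" for x
    using assms(2)[of x] that unfolding parent_graph_def by simp
qed (simp_all add: parent_graph_def assms(1))

lemma (in rooted_tree) leaf_iff:
  assumes "pverts T = V" "parcs T = A" "v \<in> V" "v \<noteq> root"
  shows "is_leaf T v \<longleftrightarrow> children v = {}"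
proof
  assume "is_leaf T v"
  then have "card (children v \<union> {par v}) = 1" using assms neighbors[of v] by (simp add: is_leaf_iff)
  moreover have "par v \<notin> children v"
    using dp_children[of "par v" v] dp_par[of v] assms by auto
  ultimately show "children v = {}" by (auto simp: card_1_singleton_iff)
qed (use assms childless_is_leaf in blast)

text \<open>Apart from children, only the parent could be a leaf neighbour, and the hypotheses keep
  it from being a leaf.\<close>

lemma (in rooted_tree) leaf_neighbors_eq:
  assumes T: "pverts T = V" "parcs T = A" and root: "\<not> is_leaf T root" and v: "v \<in> V"
    and par: "v \<noteq> root \<Longrightarrow> par v = root \<or> children (par v) \<noteq> {}"
  shows "leaf_neighbors T v = {w \<in> children v. children w = {}}"
proof -
  have "\<not> is_leaf T (par v)" if "v \<noteq> root"
    using par[OF that] leaf_iff[OF T par_in[OF v that]] root by blast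
  moreover have "is_leaf T w \<longleftrightarrow> children w = {}" if "w \<in> children v" for w
    using leaf_iff[OF T, of w] that by (auto simp: children_def)
  moreover have "(v, w) \<in> A \<longleftrightarrow> w \<in> children v \<union> (if v = root then {} else {par v})" for w
    using neighbors[OF v] by blast
  ultimately show ?thesis by (auto simp: leaf_neighbors_def T split: if_splits)
qed

lemma leaf_alpha_eqI:
  assumes "finite (pverts T)" "v \<in> pverts T"
    and "\<And>x. x \<in> pverts T \<Longrightarrow> card (leaf_neighbors T x) \<le> card (leaf_neighbors T v)"
  shows "leaf_alpha T = card (leaf_neighbors T v)"
  unfolding leaf_alpha_def using assms by (intro Max_eqI) auto

text \<open>The centre is the only maximal vertex, with \<alpha> = 2^k, hence \<beta> = 2^k - 1.
  With the centre at the origin, the leaves at all corners of the cube and all radii 1, distinct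
  corners are at distance 2 and their open balls do not meet.\<close>

lemma star_attains:
  assumes k: "1 \<le> k"
  defines "T \<equiv> parent_graph (2 ^ k) (\<lambda>_. 0)"
  shows "undirected_tree T" "2 \<le> card (pverts T)" "leaf_beta T = 2 ^ k - 1" "SIG_inf T = k"
proof -
  let ?n = "2 ^ k :: nat"
  have n2: "2 \<le> ?n" using power_increasing[OF k, of "2::nat"] by simp
  have rt: "rooted_tree (pverts T) (parcs T) 0 (\<lambda>_. 0) (\<lambda>x. if x = 0 then 0 else 1)"
    unfolding T_def by (rule parent_graph_rooted_tree) auto
  interpret rooted_tree "pverts T" "parcs T" 0 "\<lambda>_. 0" "\<lambda>x. if x = 0 then 0 else 1" by (rule rt)
  have V: "pverts T = {..?n}" by (simp add: T_def parent_graph_def)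
  have ch: "children x = (if x = 0 then {1..?n} else {})" for x
    unfolding children_def unfolding V by auto
  have "\<lparr>pverts = pverts T, parcs = parcs T\<rparr> = T" by simp
  then show tree: "undirected_tree T" using undirected_tree_rooted_converse by (simp only:)
  show card: "2 \<le> card (pverts T)" using n2 by (simp add: V)
  have "{y. (0, y) \<in> parcs T} = {1..?n}" unfolding neighbors[OF root_in] ch by simp
  then have root: "\<not> is_leaf T 0" using n2 k unfolding is_leaf_iff by simp
  have ln: "leaf_neighbors T x = (if x = 0 then {1..?n} else {})" if "x \<in> pverts T" for x
  proof -
    have "leaf_neighbors T x = {w \<in> children x. children w = {}}"
      by (rule leaf_neighbors_eq[OF refl refl root that]) simp
    then show ?thesis unfolding ch by auto
  qed
  have \<alpha>: "leaf_alpha T = ?n"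
    using leaf_alpha_eqI[of T 0] ln by (auto simp: V)
  have "max_leaf_vertices T = {0}"
    using ln n2 by (auto simp: max_leaf_vertices_def \<alpha> V split: if_splits)
  then show \<beta>: "leaf_beta T = 2 ^ k - 1" by (simp add: leaf_beta_def \<alpha>)
  have "card {1..?n} = card (sign_patterns k)" by (simp add: card_sign_patterns)
  then obtain \<epsilon> where \<epsilon>: "bij_betw \<epsilon> {1..?n} (sign_patterns k)"
    using finite_same_card_bij[of "{1..?n}" "sign_patterns k"] finite_sign_patterns by blast
  define f where "f x = (if x = 0 then (\<lambda>_. 0) else \<epsilon> x)" for x
  have abs1: "\<bar>\<epsilon> x i\<bar> = 1" if "x \<in> {1..?n}" "i \<in> {1..k}" for x i
  proof -
    have "\<epsilon> x \<in> sign_patterns k" using bij_betwE[OF \<epsilon>] that(1) by blast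
    from sign_patterns_value[OF this that(2)] show ?thesis by auto
  qed
  have arcs: "(x, y) \<in> parcs T \<longleftrightarrow> x \<le> ?n \<and> y \<le> ?n \<and> x \<noteq> y \<and> (x = 0 \<or> y = 0)" for x y
    by (auto simp: T_def parent_graph_def)
  have far: "\<exists>i\<in>{1..k}. 2 \<le> \<bar>\<epsilon> x i - \<epsilon> y i\<bar>" if xy: "x \<in> {1..?n}" "y \<in> {1..?n}" "x \<noteq> y" for x y
  proof -
    have s: "\<epsilon> x \<in> sign_patterns k" "\<epsilon> y \<in> sign_patterns k" "\<epsilon> x \<noteq> \<epsilon> y"
      using bij_betwE[OF \<epsilon>] bij_betw_imp_inj_on[OF \<epsilon>] xy by (blast dest: inj_onD)+
    then obtain i where i: "i \<in> {1..k}" "\<epsilon> x i \<noteq> \<epsilon> y i" using sign_patterns_neq by blast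
    with sign_patterns_value[OF s(1) i(1)] sign_patterns_value[OF s(2) i(1)] show ?thesis
      by (intro bexI[OF _ i(1)]) auto
  qed
  have "edge_compatible k (parcs T) f (\<lambda>_. 1) x y"
    if xy: "x \<in> pverts T" "y \<in> pverts T" "x \<noteq> y" for x y
  proof -
    have le: "x \<le> ?n" "y \<le> ?n" using xy by (simp_all add: V)
    have one: "1 \<in> {1..k}" using k by simp
    consider "x = 0" "y \<in> {1..?n}" | "y = 0" "x \<in> {1..?n}" | "x \<in> {1..?n}" "y \<in> {1..?n}"
      using le xy(3) by (cases "x = 0"; cases "y = 0") auto
    then show ?thesis
    proof cases
      case 1
      then have "\<bar>f x i - f y i\<bar> = 1" if "i \<in> {1..k}" for i using abs1[of y i] that by (simp add: f_def)
      with 1 le one show ?thesis unfolding edge_compatible_def by (auto simp: arcs)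
    next
      case 2
      then have "\<bar>f x i - f y i\<bar> = 1" if "i \<in> {1..k}" for i using abs1[of x i] that by (simp add: f_def)
      with 2 le one show ?thesis unfolding edge_compatible_def by (auto simp: arcs)
    next
      case 3
      with xy(3) far[OF 3 xy(3)] show ?thesis unfolding edge_compatible_def by (auto simp: arcs f_def)
    qed
  qed
  moreover have "\<exists>y\<in>pverts T. y \<noteq> x \<and> (\<forall>i\<in>{1..k}. \<bar>f x i - f y i\<bar> \<le> 1)" if x: "x \<in> pverts T" for x
  proof (cases "x = 0")
    case True
    with abs1[of 1] n2 show ?thesis by (intro bexI[of _ 1]) (auto simp: f_def V)
  next
    case False
    with abs1[of x] x show ?thesis by (intro bexI[of _ 0]) (auto simp: f_def V)
  qed
  ultimately have "sig_layout k (parcs T) f (\<lambda>_. 1) (pverts T)" by (simp add: sig_layout_def)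
  then have "SIG_inf T \<le> k" using SIG_inf_le[OF _ k card] tree by (simp add: undirected_tree_def)
  then show "SIG_inf T = k" using SIG_inf_power[OF tree card k \<beta>] by auto
qed

text \<open>Vertex 0 is the centre \<open>w\<close> and 1, ..., \<open>m\<close> are its neighbours,
  one more than there are orthants. The rest of {1, ..., \<open>m * 2 ^ k\<close>} is dealt out by
  residues modulo \<open>m\<close>: each class has 2^k members, namely one neighbour of
  \<open>w\<close> and its 2^k - 1 leaves.\<close>

lemma saturated_spider_attains:
  assumes k: "1 \<le> k"
  defines "m \<equiv> 2 ^ k + 1"
  defines "par \<equiv> \<lambda>i. if i \<le> m then 0 else 1 + (i - 1) mod m"
  defines "T \<equiv> parent_graph (m * 2 ^ k) par"
  shows "undirected_tree T" "2 \<le> card (pverts T)" "leaf_beta T = 2 ^ k - 1" "SIG_inf T = k + 1"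
proof -
  let ?n = "m * 2 ^ k"
  define dp where "dp i = (if i = 0 then 0 else if i \<le> m then 1 else 2 :: nat)" for i
  have n2: "(2::nat) \<le> 2 ^ k" using power_increasing[OF k, of "2::nat"] by simp
  have m: "3 \<le> m" using n2 by (simp add: m_def)
  have "m * 1 \<le> ?n" using n2 by (intro mult_le_mono) auto
  then have mn: "m \<le> ?n" by simp
  have par_lo: "par i = 0" if "i \<le> m" for i using that by (simp add: par_def)
  have par_hi: "par i = 1 + (i - 1) mod m" if "m < i" for i using that by (simp add: par_def)
  have par_range: "1 \<le> par i \<and> par i \<le> m" if "m < i" for i
    using that mod_less_divisor[of m "i - 1"] m by (auto simp: par_def Suc_le_eq)
  have "rooted_tree (pverts T) (parcs T) 0 par dp"
    unfolding T_def
  proof (rule parent_graph_rooted_tree)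
    fix x assume x: "0 < x" "x \<le> ?n"
    show "par x \<le> ?n \<and> dp x = Suc (dp (par x))"
    proof (cases "x \<le> m")
      case True with x show ?thesis by (simp add: par_lo dp_def)
    next
      case False
      then have p: "1 \<le> par x" "par x \<le> m" using par_range[of x] by auto
      from le_trans[OF p(2) mn] p False show ?thesis by (simp add: dp_def)
    qed
  qed (simp add: dp_def)
  then interpret rooted_tree "pverts T" "parcs T" 0 par dp .
  have V: "pverts T = {..?n}" by (simp add: T_def parent_graph_def)
  have ch_iff: "w \<in> children v \<longleftrightarrow> w \<le> ?n \<and> w \<noteq> 0 \<and> par w = v" for v w
    unfolding children_def unfolding V by auto
  have ch0: "children 0 = {1..m}"
  proof (intro set_eqI iffI)
    fix x assume "x \<in> children 0"
    then show "x \<in> {1..m}" using par_range[of x] by (cases "x \<le> m") (auto simp: ch_iff)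
  next
    fix x assume "x \<in> {1..m}"
    then show "x \<in> children 0" using mn le_trans[of x m ?n] by (simp add: ch_iff par_lo)
  qed
  have ch_leaf: "children x = {}" if "m < x" for x
  proof -
    have False if w: "w \<in> children x" for w
      using w par_range[of w] \<open>m < x\<close> by (cases "w \<le> m") (auto simp: ch_iff par_lo)
    then show ?thesis by blast
  qed
  \<comment> \<open>The factor \<open>a\<close> starts at 1 because \<open>a = 0\<close> is
    \<open>c\<close> itself.\<close>
  have ch_mid: "children c = (\<lambda>a. c + m * a) ` {1..<2 ^ k}" if c: "c \<in> {1..m}" for c
  proof (intro set_eqI iffI)
    fix x assume x: "x \<in> children c"
    then have "m < x" using c par_lo[of x] by (cases "x \<le> m") (auto simp: ch_iff)
    then have xc: "1 + (x - 1) mod m = c" "x \<le> ?n" using x par_hi[of x] by (auto simp: ch_iff)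
    define a where "a = (x - 1) div m"
    have "m * a + (x - 1) mod m = x - 1" by (simp add: a_def)
    then have xa: "x = c + m * a" using xc(1) \<open>m < x\<close> by linarith
    have "a \<noteq> 0" using xa \<open>m < x\<close> c by (intro notI) simp
    moreover have "1 \<le> c" "c + m * a \<le> ?n" using xa xc(2) c by auto
    then have "m * a < m * 2 ^ k" by linarith
    then have "a < 2 ^ k" by simp
    ultimately show "x \<in> (\<lambda>a. c + m * a) ` {1..<2 ^ k}" using xa by auto
  next
    fix x assume "x \<in> (\<lambda>a. c + m * a) ` {1..<2 ^ k}"
    then obtain a where "x = c + m * a" "a \<in> {1..<2 ^ k}" by blast
    then have a: "x = c + m * a" "1 \<le> a" "a + 1 \<le> 2 ^ k" by simp_all
    have c1: "1 \<le> c" "c \<le> m" using c by simp_all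
    have "m * 1 \<le> m * a" using a(2) by (intro mult_le_mono le_refl)
    then have "m < x" using a(1) c1 by linarith
    moreover have "m * (a + 1) \<le> ?n" using a(3) by (intro mult_le_mono le_refl)
    then have "x \<le> ?n" using a(1) c1 by (simp only: distrib_left)
    moreover have "(x - 1) mod m = c - 1"
    proof -
      have "x - 1 = (c - 1) + m * a" using a(1) c1 by linarith
      then have "(x - 1) mod m = (c - 1) mod m" by (simp only: mod_mult_self2)
      also have "\<dots> = c - 1" using c1 by (intro mod_less) linarith
      finally show ?thesis .
    qed
    ultimately show "x \<in> children c" using c1 par_hi[of x] by (simp add: ch_iff)
  qed
  have card_mid: "card (children c) = 2 ^ k - 1" if "c \<in> {1..m}" for c
    using m by (simp add: ch_mid[OF that] card_image inj_on_def)
  have ne_mid: "children c \<noteq> {}" if "c \<in> {1..m}" for c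
    using card_mid[OF that] n2 by auto
  have "\<lparr>pverts = pverts T, parcs = parcs T\<rparr> = T" by simp
  then show tree: "undirected_tree T" using undirected_tree_rooted_converse by (simp only:)
  show card: "2 \<le> card (pverts T)" using mn m by (simp add: V)
  have nb0: "{y. (0, y) \<in> parcs T} = {1..m}" unfolding neighbors[OF root_in] ch0 by simp
  then have root: "\<not> is_leaf T 0" using m unfolding is_leaf_iff by simp
  have ln: "leaf_neighbors T x = (if x \<in> {1..m} then children x else {})" if x: "x \<in> pverts T" for x
  proof -
    have ln': "leaf_neighbors T x = {w \<in> children x. children w = {}}"
    proof (rule leaf_neighbors_eq[OF refl refl root x])
      show "par x = 0 \<or> children (par x) \<noteq> {}"
        using par_range[of x] ne_mid by (cases "x \<le> m") (auto simp: par_lo)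
    qed
    consider "x = 0" | "x \<in> {1..m}" | "m < x" by force
    then show ?thesis
    proof cases
      case 1
      then have "{w \<in> children x. children w = {}} = {}" using ch0 ne_mid by blast
      with 1 ln' show ?thesis by simp
    next
      case 2
      have "m < w" if "w \<in> children x" for w
        using that 2 par_lo[of w] by (cases "w \<le> m") (auto simp: ch_iff)
      then have "{w \<in> children x. children w = {}} = children x" using ch_leaf by blast
      with 2 ln' show ?thesis by simp
    next
      case 3
      with ch_leaf[OF 3] ln' show ?thesis by simp
    qed
  qed
  have mV: "c \<in> pverts T" if "c \<in> {1..m}" for c
    using that le_trans[OF _ mn] unfolding V by (simp only: atLeastAtMost_iff atMost_iff)
  have cln: "card (leaf_neighbors T c) = 2 ^ k - 1" if "c \<in> {1..m}" for c
    using ln[OF mV[OF that]] card_mid[OF that] that by simp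
  have m12: "1 \<in> {1..m}" "2 \<in> {1..m}" using m by auto
  have "leaf_alpha T = card (leaf_neighbors T 1)"
  proof (rule leaf_alpha_eqI[OF _ mV[OF m12(1)]])
    show "card (leaf_neighbors T x) \<le> card (leaf_neighbors T 1)" if "x \<in> pverts T" for x
      using ln[OF that] cln[OF m12(1)] card_mid by simp
  qed (simp add: V)
  then have \<alpha>: "leaf_alpha T = 2 ^ k - 1" using cln[OF m12(1)] by simp
  \<comment> \<open>Two maximal vertices are enough for \<beta> = \<alpha>.\<close>
  have "{1, 2} \<subseteq> max_leaf_vertices T"
    using cln m12 mV \<alpha> by (auto simp: max_leaf_vertices_def)
  then have "card {1, 2 :: nat} \<le> card (max_leaf_vertices T)"
    by (intro card_mono) (auto simp: max_leaf_vertices_def V)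
  then show \<beta>: "leaf_beta T = 2 ^ k - 1" using \<alpha> by (simp add: leaf_beta_def)
  have "SIG_inf T \<noteq> k"
  proof
    assume "SIG_inf T = k"
    then obtain f r where lay: "sig_layout k (parcs T) f r (pverts T)"
      using SIG_inf_layout(2)[OF tree card] by auto
    interpret G: pair_graph T using tree by (simp add: undirected_tree_def)
    interpret tree_layout T k f r by unfold_locales (rule lay)
    have "card {1..m} \<le> 2 ^ k"
    proof (rule saturated_neighbors_bound[OF _ root])
      show "(0, x) \<in> parcs T \<and> card (leaf_neighbors T x) + 1 = 2 ^ k" if "x \<in> {1..m}" for x
        using cln[OF that] n2 nb0 that by auto
      show "(x, y) \<notin> parcs T" if "x \<in> {1..m}" "y \<in> {1..m}" for x y
        using that par_lo[of x] par_lo[of y] by (auto simp: arc_iff)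
    qed
    then show False by (simp add: m_def)
  qed
  then show "SIG_inf T = k + 1" using SIG_inf_power[OF tree card k \<beta>] by auto
qed

theorem mainTheorem1:
  shows "(\<forall>T :: 'a pair_pre_digraph. undirected_tree T \<and> 2 \<le> card (pverts T) \<longrightarrow>
            ((\<nexists>k::nat. 1 \<le> k \<and> leaf_beta T = 2 ^ k - 1) \<longrightarrow>
               int (SIG_inf T) = \<lceil>log 2 (real (leaf_beta T) + 2)\<rceil>) \<and>
            (\<forall>k::nat. 1 \<le> k \<and> leaf_beta T = 2 ^ k - 1 \<longrightarrow>
               SIG_inf T \<in> {k, k + 1}))
       \<and> (\<forall>k::nat. 1 \<le> k \<longrightarrow>
            (\<exists>T1 :: nat pair_pre_digraph. undirected_tree T1 \<and> 2 \<le> card (pverts T1) \<and>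
               leaf_beta T1 = 2 ^ k - 1 \<and> SIG_inf T1 = k) \<and>
            (\<exists>T2 :: nat pair_pre_digraph. undirected_tree T2 \<and> 2 \<le> card (pverts T2) \<and>
               leaf_beta T2 = 2 ^ k - 1 \<and> SIG_inf T2 = k + 1))"
proof (intro conjI allI impI)
  fix T :: "'a pair_pre_digraph"
  assume T: "undirected_tree T \<and> 2 \<le> card (pverts T)"
  show "int (SIG_inf T) = \<lceil>log 2 (real (leaf_beta T) + 2)\<rceil>"
    if "\<nexists>k::nat. 1 \<le> k \<and> leaf_beta T = 2 ^ k - 1"
    using SIG_inf_eq_log[OF _ _ that] T by simp
  show "SIG_inf T \<in> {k, k + 1}" if "1 \<le> k \<and> leaf_beta T = 2 ^ k - 1" for k
    using SIG_inf_power T that by blast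
next
  fix k :: nat
  assume k: "1 \<le> k"
  show "\<exists>T1 :: nat pair_pre_digraph. undirected_tree T1 \<and> 2 \<le> card (pverts T1) \<and>
      leaf_beta T1 = 2 ^ k - 1 \<and> SIG_inf T1 = k"
    using star_attains[OF k] by blast
  show "\<exists>T2 :: nat pair_pre_digraph. undirected_tree T2 \<and> 2 \<le> card (pverts T2) \<and>
      leaf_beta T2 = 2 ^ k - 1 \<and> SIG_inf T2 = k + 1"
    using saturated_spider_attains[OF k] by blast
qed

end
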